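(* Let $k$ be an algebraically closed field of characteristic $2$. For every $n\ge2$ there exists a simple $G$-action over $k$, where $G=Q_{2^{n+1}}$ is the generalized quaternion group of order $2^{n+1}$.
   Context: $G=Q_{2^{n+1}}=\langle\sigma,\tau\mid\tau^{2^n}=1,\ \tau^{2^{n-1}}=\sigma^2,\ \sigma\tau\sigma^{-1}=\tau^{-1}\rangle$. Set $H_0=\langle\tau\rangle$, $H_1=\langle\sigma\rangle$, $H_2=\langle\sigma\tau\rangle$. For $i=0,1,2$ let $\chi_i:G\to\{\pm1\}$ be the unique character of order $2$ with $H_i\subset\mathrm{Ker}(\chi_i)$. A local $G$-action over $k$ is a faithful $k$-linear action $\phi:G\hookrightarrow\mathrm{Aut}_k(k[[z]])$ on a ring of formal power series in one variable. The Artin character $a_\phi$ is the character of $G$ with $a_\phi(g)=-\mathrm{ord}_z(g(z)-z)$ for $g\ne1$ and $a_\phi(1)=-\sum_{g\neq1}a_\phi(g)$. For a character $\chi$ of $G$ we write $a_\phi(\chi):=\langle\chi,a_\phi\rangle_G=|G|^{-1}\sum_{g\in G}\overline{\chi(g)}\,a_\phi(g)$. A local $G$-action $\phi$ is called simple if $a_\phi(\chi_0)=2$ and $a_\phi(\chi_1)=a_\phi(\chi_2)\ge2$. *)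

theory Defs
  imports
    "HOL-Algebra.Generated_Groups"
    "HOL-Computational_Algebra.Computational_Algebra"
    "HOL-Library.Complex_Order"
begin

section \<open>Groups given by generators and relations\<close>

datatype 'a letter = Gen 'a | Inv 'a

fun inv_letter :: "'a letter \<Rightarrow> 'a letter" where
  "inv_letter (Gen x) = Inv x"
| "inv_letter (Inv x) = Gen x"

text \<open>The least monoid congruence on words that contains \<open>x x\<^sup>-\<^sup>1 = 1 = x\<^sup>-\<^sup>1 x\<close> and the relations \<open>R\<close>.\<close>

inductive pres_eq :: "('a letter list \<times> 'a letter list) set \<Rightarrow> 'a letter list \<Rightarrow> 'a letter list \<Rightarrow> bool"
  for R where
  pres_rel: "(u, v) \<in> R \<Longrightarrow> pres_eq R u v"
| pres_cancel: "pres_eq R [x, inv_letter x] []"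
| pres_refl: "pres_eq R u u"
| pres_sym: "pres_eq R u v \<Longrightarrow> pres_eq R v u"
| pres_trans: "pres_eq R u v \<Longrightarrow> pres_eq R v w \<Longrightarrow> pres_eq R u w"
| pres_app: "pres_eq R u v \<Longrightarrow> pres_eq R u' v' \<Longrightarrow> pres_eq R (u @ u') (v @ v')"

definition pres_class :: "('a letter list \<times> 'a letter list) set \<Rightarrow> 'a letter list \<Rightarrow> 'a letter list set" where
  "pres_class R u = {v. pres_eq R u v}"

definition presented_group :: "('a letter list \<times> 'a letter list) set \<Rightarrow> 'a letter list set monoid" where
  "presented_group R =
     \<lparr>carrier = range (pres_class R),
      monoid.mult = (\<lambda>A B. \<Union>a\<in>A. \<Union>b\<in>B. pres_class R (a @ b)),
      monoid.one = pres_class R []\<rparr>"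

lemma pres_class_eq_iff: "pres_class R u = pres_class R v \<longleftrightarrow> pres_eq R u v"
  unfolding pres_class_def by (blast intro: pres_refl pres_sym pres_trans)

lemma presented_group_carrier: "carrier (presented_group R) = range (pres_class R)"
  by (simp add: presented_group_def)

lemma presented_group_one: "\<one>\<^bsub>presented_group R\<^esub> = pres_class R []"
  by (simp add: presented_group_def)

lemma presented_group_mult:
  "pres_class R u \<otimes>\<^bsub>presented_group R\<^esub> pres_class R v = pres_class R (u @ v)"
proof -
  have eq: "pres_class R (a @ b) = pres_class R (u @ v)"
    if "a \<in> pres_class R u" "b \<in> pres_class R v" for a b
  proof -
    from that have "pres_eq R (u @ v) (a @ b)"
      unfolding pres_class_def by (blast intro: pres_app)
    then show ?thesis
      by (simp only: pres_class_eq_iff pres_sym)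
  qed
  have "(\<Union>a\<in>pres_class R u. \<Union>b\<in>pres_class R v. pres_class R (a @ b))
      = (\<Union>a\<in>pres_class R u. \<Union>b\<in>pres_class R v. pres_class R (u @ v))"
    by (intro SUP_cong refl eq)
  moreover have "u \<in> pres_class R u" "v \<in> pres_class R v"
    by (simp_all add: pres_class_def pres_refl)
  then have "pres_class R u \<noteq> {}" "pres_class R v \<noteq> {}"
    by (simp_all only: ex_in_conv[symmetric]) blast+
  ultimately show ?thesis
    by (simp add: presented_group_def)
qed

lemma inv_letter_inv_letter [simp]: "inv_letter (inv_letter x) = x"
  by (cases x) auto

lemma pres_eq_inverse: "pres_eq R (rev (map inv_letter u) @ u) []"
proof (induction u)
  case Nil
  show ?case by (simp add: pres_refl)
next
  case (Cons x u)
  have "pres_eq R ([inv_letter x, x] @ u) ([] @ u)"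
    using pres_app[OF pres_cancel[of R "inv_letter x"] pres_refl] by simp
  then have "pres_eq R (rev (map inv_letter u) @ [inv_letter x, x] @ u) (rev (map inv_letter u) @ u)"
    using pres_app[OF pres_refl] by fastforce
  then show ?case
    using Cons.IH pres_trans by fastforce
qed

lemma presented_group_group: "group (presented_group R)"
proof (rule groupI)
  fix A assume "A \<in> carrier (presented_group R)"
  then obtain u where A: "A = pres_class R u"
    by (auto simp: presented_group_carrier)
  have "pres_class R (rev (map inv_letter u)) \<otimes>\<^bsub>presented_group R\<^esub> A = \<one>\<^bsub>presented_group R\<^esub>"
    by (simp add: A presented_group_mult presented_group_one pres_class_eq_iff pres_eq_inverse)
  then show "\<exists>B\<in>carrier (presented_group R). B \<otimes>\<^bsub>presented_group R\<^esub> A = \<one>\<^bsub>presented_group R\<^esub>"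
    by (auto simp: presented_group_carrier)
qed (simp_all add: presented_group_carrier presented_group_one,
    safe, simp_all add: presented_group_mult)

fun letter_eval :: "('b, 'c) monoid_scheme \<Rightarrow> ('a \<Rightarrow> 'b) \<Rightarrow> 'a letter \<Rightarrow> 'b" where
  "letter_eval K f (Gen x) = f x"
| "letter_eval K f (Inv x) = inv\<^bsub>K\<^esub> (f x)"

definition word_eval :: "('b, 'c) monoid_scheme \<Rightarrow> ('a \<Rightarrow> 'b) \<Rightarrow> 'a letter list \<Rightarrow> 'b" where
  "word_eval K f u = foldr (\<lambda>x g. letter_eval K f x \<otimes>\<^bsub>K\<^esub> g) u \<one>\<^bsub>K\<^esub>"

lemma word_eval_simps [simp]:
  "word_eval K f [] = \<one>\<^bsub>K\<^esub>"
  "word_eval K f (x # u) = letter_eval K f x \<otimes>\<^bsub>K\<^esub> word_eval K f u"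
  by (simp_all add: word_eval_def)

lemma letter_eval_closed:
  assumes "group K" "range f \<subseteq> carrier K"
  shows "letter_eval K f x \<in> carrier K"
  using assms(2) by (cases x) (simp_all add: image_subset_iff group.inv_closed[OF assms(1)])

lemma word_eval_closed:
  assumes "group K" "range f \<subseteq> carrier K"
  shows "word_eval K f u \<in> carrier K"
proof -
  interpret group K by fact
  show ?thesis
    by (induction u) (simp_all add: letter_eval_closed[OF assms])
qed

lemma word_eval_append:
  assumes "group K" "range f \<subseteq> carrier K"
  shows "word_eval K f (u @ v) = word_eval K f u \<otimes>\<^bsub>K\<^esub> word_eval K f v"
proof -
  interpret group K by fact
  show ?thesis
    by (induction u)
      (simp_all add: letter_eval_closed[OF assms] word_eval_closed[OF assms] m_assoc)
qed

lemma word_eval_pres_eq: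
  assumes "group K" "range f \<subseteq> carrier K"
    and "\<And>u v. (u, v) \<in> R \<Longrightarrow> word_eval K f u = word_eval K f v"
    and "pres_eq R u v"
  shows "word_eval K f u = word_eval K f v"
proof -
  interpret group K by fact
  show ?thesis
    using assms(4)
  proof induction
    case (pres_cancel x)
    have "letter_eval K f x \<otimes>\<^bsub>K\<^esub> letter_eval K f (inv_letter x) = \<one>\<^bsub>K\<^esub>"
      using assms(2) by (cases x) (auto simp: image_subset_iff)
    then show ?case
      by (simp add: letter_eval_closed[OF assms(1,2)])
  qed (simp_all add: assms(3) word_eval_append[OF assms(1,2)])
qed

text \<open>The universal property of the presentation.\<close>

lemma presented_group_universal:
  assumes "group K" "range f \<subseteq> carrier K"
    and "\<And>u v. (u, v) \<in> R \<Longrightarrow> word_eval K f u = word_eval K f v"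
  obtains h where "h \<in> hom (presented_group R) K"
    and "\<And>u. h (pres_class R u) = word_eval K f u"
proof
  define h where "h A = word_eval K f (SOME u. u \<in> A)" for A
  show *: "h (pres_class R u) = word_eval K f u" for u
  proof -
    have "(SOME v. v \<in> pres_class R u) \<in> pres_class R u"
      by (rule someI[of _ u]) (simp add: pres_class_def pres_refl)
    then have "pres_eq R u (SOME v. v \<in> pres_class R u)"
      by (simp add: pres_class_def)
    then show ?thesis
      unfolding h_def using word_eval_pres_eq[OF assms] by metis
  qed
  show "h \<in> hom (presented_group R) K"
    by (auto simp: hom_def presented_group_carrier presented_group_mult *
        word_eval_closed[OF assms(1,2)] word_eval_append[OF assms(1,2)])
qed

section \<open>The generalized quaternion group\<close>

datatype quat_gen = Sigma | Tau

definition quat_rels :: "nat \<Rightarrow> (quat_gen letter list \<times> quat_gen letter list) set" where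
  "quat_rels n =
     {(replicate (2 ^ n) (Gen Tau), []),
      (replicate (2 ^ (n - 1)) (Gen Tau), [Gen Sigma, Gen Sigma]),
      ([Gen Sigma, Gen Tau, Inv Sigma], [Inv Tau])}"

definition quat_group :: "nat \<Rightarrow> quat_gen letter list set monoid" where
  "quat_group n = presented_group (quat_rels n)"

definition quat_sigma :: "nat \<Rightarrow> quat_gen letter list set" where
  "quat_sigma n = pres_class (quat_rels n) [Gen Sigma]"

definition quat_tau :: "nat \<Rightarrow> quat_gen letter list set" where
  "quat_tau n = pres_class (quat_rels n) [Gen Tau]"

lemma quat_group_group: "group (quat_group n)"
  by (simp add: quat_group_def presented_group_group)

lemma quat_sigma_closed: "quat_sigma n \<in> carrier (quat_group n)"
  and quat_tau_closed: "quat_tau n \<in> carrier (quat_group n)"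
  by (auto simp: quat_sigma_def quat_tau_def quat_group_def presented_group_carrier)

lemma quat_class_inv:
  "inv\<^bsub>quat_group n\<^esub> pres_class (quat_rels n) u = pres_class (quat_rels n) (rev (map inv_letter u))"
proof -
  interpret group "quat_group n" by (rule quat_group_group)
  show ?thesis
    by (rule inv_equality)
      (auto simp: quat_group_def presented_group_mult presented_group_carrier presented_group_one
        pres_class_eq_iff pres_eq_inverse)
qed

lemma quat_class_pow:
  "pres_class (quat_rels n) [x] [^]\<^bsub>quat_group n\<^esub> (m::nat) = pres_class (quat_rels n) (replicate m x)"
proof (induction m)
  case 0
  show ?case by (simp add: quat_group_def presented_group_one)
next
  case (Suc m)
  then show ?case
    by (simp add: quat_group_def presented_group_mult replicate_append_same)
qed

lemma quat_relations:
  "quat_tau n [^]\<^bsub>quat_group n\<^esub> (2 ^ n :: nat) = \<one>\<^bsub>quat_group n\<^esub>"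
  "quat_tau n [^]\<^bsub>quat_group n\<^esub> (2 ^ (n - 1) :: nat) = quat_sigma n \<otimes>\<^bsub>quat_group n\<^esub> quat_sigma n"
  "quat_sigma n \<otimes>\<^bsub>quat_group n\<^esub> quat_tau n \<otimes>\<^bsub>quat_group n\<^esub> inv\<^bsub>quat_group n\<^esub> quat_sigma n
     = inv\<^bsub>quat_group n\<^esub> quat_tau n"
  unfolding quat_tau_def quat_sigma_def quat_class_pow quat_class_inv
  unfolding quat_group_def presented_group_one presented_group_mult pres_class_eq_iff
  by (rule pres_rel; simp add: quat_rels_def)+

lemma quat_group_hom_ext:
  assumes "h \<in> hom (quat_group n) K" "h' \<in> hom (quat_group n) K" "group K"
    and "h (quat_sigma n) = h' (quat_sigma n)" "h (quat_tau n) = h' (quat_tau n)"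
    and "g \<in> carrier (quat_group n)"
  shows "h g = h' g"
proof -
  interpret group "quat_group n" by (rule quat_group_group)
  interpret h: group_hom "quat_group n" K h
    by (simp add: group_hom_def group_hom_axioms_def assms quat_group_group)
  interpret h': group_hom "quat_group n" K h'
    by (simp add: group_hom_def group_hom_axioms_def assms quat_group_group)
  have cl: "pres_class (quat_rels n) u \<in> carrier (quat_group n)" for u
    by (auto simp: quat_group_def presented_group_carrier)
  have app: "pres_class (quat_rels n) (x # u)
      = pres_class (quat_rels n) [x] \<otimes>\<^bsub>quat_group n\<^esub> pres_class (quat_rels n) u" for x u
    by (simp add: quat_group_def presented_group_mult)
  have gen: "h (pres_class (quat_rels n) [Gen y]) = h' (pres_class (quat_rels n) [Gen y])" for y
    using assms(4,5) by (cases y) (auto simp: quat_sigma_def quat_tau_def)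
  have lett: "h (pres_class (quat_rels n) [x]) = h' (pres_class (quat_rels n) [x])" for x
  proof (cases x)
    case (Inv y)
    then have "pres_class (quat_rels n) [x] = inv\<^bsub>quat_group n\<^esub> pres_class (quat_rels n) [Gen y]"
      by (simp add: quat_class_inv)
    then show ?thesis
      using gen[of y] cl by (simp add: h.hom_inv h'.hom_inv)
  qed (use gen in auto)
  have "h (pres_class (quat_rels n) u) = h' (pres_class (quat_rels n) u)" for u
  proof (induction u)
    case Nil
    show ?case
      using h.hom_one h'.hom_one by (simp add: quat_group_def presented_group_one)
  next
    case (Cons x u)
    then show ?case
      using lett[of x] by (subst (1 2) app) (simp add: cl)
  qed
  then show ?thesis
    using assms(6) by (auto simp: quat_group_def presented_group_carrier)
qed

text \<open>
  A model of the group on normal forms \<open>\<tau>\<^sup>a \<sigma>\<^sup>b\<close>, used to see that the presentation defines a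
  group of order \<open>2\<^bsup>n+1\<^esup>\<close>.
\<close>

definition quat_model :: "nat \<Rightarrow> (int \<times> bool) monoid" where
  "quat_model n =
     \<lparr>carrier = {0..<2 ^ n} \<times> UNIV,
      monoid.mult = (\<lambda>(a, b) (c, d).
        ((a + (if b then - c else c) + (if b \<and> d then 2 ^ (n - 1) else 0)) mod 2 ^ n, b \<noteq> d)),
      monoid.one = (0, False)\<rparr>"

lemma quat_model_mult:
  "(a, b) \<otimes>\<^bsub>quat_model n\<^esub> (c, d) =
     ((a + (if b then - c else c) + (if b \<and> d then 2 ^ (n - 1) else 0)) mod 2 ^ n, b \<noteq> d)"
  by (simp add: quat_model_def)

lemma quat_model_group:
  assumes "n \<ge> 2"
  shows "group (quat_model n)"
proof (rule groupI)
  have N: "(2::int) ^ n = 2 * 2 ^ (n - 1)"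
    using assms by (cases n) auto
  have eqI: "x mod 2 ^ n = y mod 2 ^ n" if "x - y = 2 ^ n * k" for x y k :: int
    using that by (metis dvd_triv_left mod_eq_dvd_iff)
  fix x assume x: "x \<in> carrier (quat_model n)"
  then obtain a b where ab: "x = (a, b)" "0 \<le> a" "a < 2 ^ n"
    by (auto simp: quat_model_def)
  show "\<one>\<^bsub>quat_model n\<^esub> \<otimes>\<^bsub>quat_model n\<^esub> x = x"
    using ab by (simp add: quat_model_def)
  show "\<exists>y\<in>carrier (quat_model n). y \<otimes>\<^bsub>quat_model n\<^esub> x = \<one>\<^bsub>quat_model n\<^esub>"
  proof (cases b)
    case True
    have "((a - 2 ^ (n - 1)) mod 2 ^ n - a + 2 ^ (n - 1)) mod 2 ^ n = 0"
      using mod_add_left_eq[of "a - 2 ^ (n - 1)" "2 ^ n" "2 ^ (n - 1) - a"] by (simp add: algebra_simps)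
    then show ?thesis
      using True ab
      by (intro bexI[of _ "((a - 2 ^ (n - 1)) mod 2 ^ n, True)"]) (simp_all add: quat_model_def)
  next
    case False
    then show ?thesis
      using ab
      by (intro bexI[of _ "((- a) mod 2 ^ n, False)"]) (simp_all add: quat_model_def mod_simps)
  qed
  fix y assume y: "y \<in> carrier (quat_model n)"
  obtain c d where cd: "y = (c, d)" by fastforce
  show "x \<otimes>\<^bsub>quat_model n\<^esub> y \<in> carrier (quat_model n)"
    by (simp add: quat_model_def ab cd)
  fix z assume z: "z \<in> carrier (quat_model n)"
  obtain e f where ef: "z = (e, f)" by fastforce
  let ?s = "\<lambda>b (x::int). if b then - x else x"
  let ?t = "\<lambda>b d. if b \<and> d then 2 ^ (n - 1) else (0::int)"
  have "((a + ?s b c + ?t b d) mod 2 ^ n + ?s (b \<noteq> d) e + ?t (b \<noteq> d) f) mod 2 ^ n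
      = (a + ?s b c + ?t b d + ?s (b \<noteq> d) e + ?t (b \<noteq> d) f) mod 2 ^ n"
    by (simp add: mod_simps add.assoc)
  also have "\<dots> = (a + ?s b (c + ?s d e + ?t d f) + ?t b (d \<noteq> f)) mod 2 ^ n"
    by (rule eqI[of _ _ "if b \<and> d \<and> f then 1 else 0"], cases b; cases d; cases f; simp only: if_True if_False simp_thms)
      (use N in linarith)+
  also have "\<dots> = (a + ?s b ((c + ?s d e + ?t d f) mod 2 ^ n) + ?t b (d \<noteq> f)) mod 2 ^ n"
  proof -
    define w where "w = c + ?s d e + ?t d f"
    define v where "v = a + ?t b (d \<noteq> f)"
    have "(v + ?s b w) mod 2 ^ n = (v + ?s b (w mod 2 ^ n)) mod 2 ^ n"
      by (cases b) (simp_all add: mod_simps)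
    then show ?thesis
      unfolding w_def v_def by (simp only: add.assoc add.commute add.left_commute)
  qed
  finally show "x \<otimes>\<^bsub>quat_model n\<^esub> y \<otimes>\<^bsub>quat_model n\<^esub> z = x \<otimes>\<^bsub>quat_model n\<^esub> (y \<otimes>\<^bsub>quat_model n\<^esub> z)"
    unfolding ab cd ef quat_model_mult prod.inject by (intro conjI) (assumption, blast)
qed (simp add: quat_model_def)

lemma quat_normal_form:
  assumes "g \<in> carrier (quat_group n)"
  obtains i :: nat and b :: bool where "i < 2 ^ n"
    "g = quat_tau n [^]\<^bsub>quat_group n\<^esub> i \<otimes>\<^bsub>quat_group n\<^esub>
       (if b then quat_sigma n else \<one>\<^bsub>quat_group n\<^esub>)"
proof -
  define G where "G = quat_group n"
  define s where "s = quat_sigma n"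
  define t where "t = quat_tau n"
  define N :: nat where "N = 2 ^ n"
  define M :: nat where "M = 2 ^ (n - 1)"
  have "N > 0"
    by (simp add: N_def)
  interpret G: group G
    unfolding G_def by (rule quat_group_group)
  have [simp]: "s \<in> carrier G" "t \<in> carrier G"
    by (simp_all add: G_def s_def t_def quat_sigma_closed quat_tau_closed)
  have tN: "t [^]\<^bsub>G\<^esub> N = \<one>\<^bsub>G\<^esub>" and ss: "s \<otimes>\<^bsub>G\<^esub> s = t [^]\<^bsub>G\<^esub> M"
    and rel: "s \<otimes>\<^bsub>G\<^esub> t \<otimes>\<^bsub>G\<^esub> inv\<^bsub>G\<^esub> s = inv\<^bsub>G\<^esub> t"
    using quat_relations[of n] by (simp_all add: G_def s_def t_def N_def M_def)
  define P where "P g \<longleftrightarrow> (\<exists>i::nat. g = t [^]\<^bsub>G\<^esub> i \<or> g = t [^]\<^bsub>G\<^esub> i \<otimes>\<^bsub>G\<^esub> s)" for g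
  have inv_t: "inv\<^bsub>G\<^esub> t = t [^]\<^bsub>G\<^esub> (N - 1)"
    using tN \<open>N > 0\<close> by (intro G.inv_equality) (auto simp flip: G.nat_pow_Suc)
  have st: "s \<otimes>\<^bsub>G\<^esub> t = t [^]\<^bsub>G\<^esub> (N - 1) \<otimes>\<^bsub>G\<^esub> s"
    using rel unfolding inv_t by (metis G.inv_solve_right \<open>s \<in> carrier G\<close> \<open>t \<in> carrier G\<close> G.m_closed G.nat_pow_closed)
  have sti: "s \<otimes>\<^bsub>G\<^esub> t [^]\<^bsub>G\<^esub> i = t [^]\<^bsub>G\<^esub> ((N - 1) * i) \<otimes>\<^bsub>G\<^esub> s" for i
  proof (induction i)
    case (Suc i)
    have "s \<otimes>\<^bsub>G\<^esub> t [^]\<^bsub>G\<^esub> Suc i = (s \<otimes>\<^bsub>G\<^esub> t [^]\<^bsub>G\<^esub> i) \<otimes>\<^bsub>G\<^esub> t"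
      by (simp add: G.m_assoc)
    also have "\<dots> = t [^]\<^bsub>G\<^esub> ((N - 1) * i) \<otimes>\<^bsub>G\<^esub> (s \<otimes>\<^bsub>G\<^esub> t)"
      unfolding Suc.IH by (simp add: G.m_assoc)
    also have "\<dots> = t [^]\<^bsub>G\<^esub> ((N - 1) * i + (N - 1)) \<otimes>\<^bsub>G\<^esub> s"
      unfolding st by (simp add: G.m_assoc flip: G.nat_pow_mult)
    finally show ?case
      by (simp add: add.commute)
  qed simp
  have Pt: "P (t \<otimes>\<^bsub>G\<^esub> g)" if "P g" for g
  proof -
    have "t \<otimes>\<^bsub>G\<^esub> t [^]\<^bsub>G\<^esub> i = t [^]\<^bsub>G\<^esub> Suc i" for i :: nat
      using G.nat_pow_mult[of t 1 i] by simp
    then have "t \<otimes>\<^bsub>G\<^esub> (t [^]\<^bsub>G\<^esub> i) = t [^]\<^bsub>G\<^esub> Suc i"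
      "t \<otimes>\<^bsub>G\<^esub> (t [^]\<^bsub>G\<^esub> i \<otimes>\<^bsub>G\<^esub> s) = t [^]\<^bsub>G\<^esub> Suc i \<otimes>\<^bsub>G\<^esub> s" for i :: nat
      by (simp_all flip: G.m_assoc)
    with that show ?thesis
      unfolding P_def by metis
  qed
  have Ps: "P (s \<otimes>\<^bsub>G\<^esub> g)" if "P g" for g
  proof -
    have "s \<otimes>\<^bsub>G\<^esub> (t [^]\<^bsub>G\<^esub> i \<otimes>\<^bsub>G\<^esub> s) = t [^]\<^bsub>G\<^esub> ((N - 1) * i + M)" for i :: nat
    proof -
      have "s \<otimes>\<^bsub>G\<^esub> (t [^]\<^bsub>G\<^esub> i \<otimes>\<^bsub>G\<^esub> s) = (s \<otimes>\<^bsub>G\<^esub> t [^]\<^bsub>G\<^esub> i) \<otimes>\<^bsub>G\<^esub> s"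
        by (simp add: G.m_assoc)
      also have "\<dots> = t [^]\<^bsub>G\<^esub> ((N - 1) * i) \<otimes>\<^bsub>G\<^esub> (s \<otimes>\<^bsub>G\<^esub> s)"
        unfolding sti by (simp add: G.m_assoc)
      finally show ?thesis
        unfolding ss by (simp add: G.nat_pow_mult)
    qed
    with that sti show ?thesis
      unfolding P_def by metis
  qed
  have Pti: "P (t [^]\<^bsub>G\<^esub> i \<otimes>\<^bsub>G\<^esub> g)" if "P g" for g and i :: nat
  proof -
    obtain j :: nat where "g = t [^]\<^bsub>G\<^esub> j \<or> g = t [^]\<^bsub>G\<^esub> j \<otimes>\<^bsub>G\<^esub> s"
      using \<open>P g\<close> unfolding P_def by blast
    then have "t [^]\<^bsub>G\<^esub> i \<otimes>\<^bsub>G\<^esub> g = t [^]\<^bsub>G\<^esub> (i + j) \<or> t [^]\<^bsub>G\<^esub> i \<otimes>\<^bsub>G\<^esub> g = t [^]\<^bsub>G\<^esub> (i + j) \<otimes>\<^bsub>G\<^esub> s"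
      by (auto simp: G.m_assoc simp flip: G.nat_pow_mult)
    then show ?thesis
      unfolding P_def by blast
  qed
  have inv_s: "inv\<^bsub>G\<^esub> s = t [^]\<^bsub>G\<^esub> ((N - 1) * M) \<otimes>\<^bsub>G\<^esub> s"
  proof (rule G.inv_equality)
    have "t [^]\<^bsub>G\<^esub> ((N - 1) * M) \<otimes>\<^bsub>G\<^esub> s \<otimes>\<^bsub>G\<^esub> s = t [^]\<^bsub>G\<^esub> ((N - 1) * M + M)"
      by (simp add: G.m_assoc ss G.nat_pow_mult)
    also have "(N - 1) * M + M = N * M"
      using \<open>N > 0\<close> by (cases N) auto
    also have "t [^]\<^bsub>G\<^esub> (N * M) = \<one>\<^bsub>G\<^esub>"
      by (simp add: tN flip: G.nat_pow_pow)
    finally show "t [^]\<^bsub>G\<^esub> ((N - 1) * M) \<otimes>\<^bsub>G\<^esub> s \<otimes>\<^bsub>G\<^esub> s = \<one>\<^bsub>G\<^esub>" .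
  qed simp_all
  have cl: "pres_class (quat_rels n) u \<in> carrier G" for u
    by (auto simp: G_def quat_group_def presented_group_carrier)
  have P_carrier: "P g \<Longrightarrow> g \<in> carrier G" for g
    by (auto simp: P_def)
  have Pinv: "P (inv\<^bsub>G\<^esub> s \<otimes>\<^bsub>G\<^esub> g)" if "P g" for g
    unfolding inv_s using Pti[OF Ps[OF that]] P_carrier[OF that] by (simp add: G.m_assoc)
  have Pw: "P (pres_class (quat_rels n) u)" for u
  proof (induction u)
    case Nil
    have "pres_class (quat_rels n) [] = t [^]\<^bsub>G\<^esub> (0::nat)"
      by (simp add: G_def quat_group_def presented_group_one)
    then show ?case
      unfolding P_def by blast
  next
    case (Cons x u)
    have app: "pres_class (quat_rels n) (x # u) = pres_class (quat_rels n) [x] \<otimes>\<^bsub>G\<^esub> pres_class (quat_rels n) u"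
      by (simp add: G_def quat_group_def presented_group_mult)
    have inv: "pres_class (quat_rels n) [Inv y] = inv\<^bsub>G\<^esub> pres_class (quat_rels n) [Gen y]" for y
      by (simp add: G_def quat_class_inv)
    consider "x = Gen Sigma" | "x = Gen Tau" | "x = Inv Sigma" | "x = Inv Tau"
      by (metis letter.exhaust quat_gen.exhaust)
    then show ?case
    proof cases
      case 1
      then show ?thesis unfolding app using Ps[OF Cons.IH] by (simp add: s_def quat_sigma_def)
    next
      case 2
      then show ?thesis unfolding app using Pt[OF Cons.IH] by (simp add: t_def quat_tau_def)
    next
      case 3
      then show ?thesis unfolding app using Pinv[OF Cons.IH] by (simp add: inv s_def quat_sigma_def)
    next
      case 4
      then show ?thesis unfolding app using Pti[OF Cons.IH, of "N - 1"] inv_t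
        by (simp add: inv t_def quat_tau_def)
    qed
  qed
  have red: "t [^]\<^bsub>G\<^esub> i = t [^]\<^bsub>G\<^esub> (i mod N)" for i :: nat
  proof -
    have "t [^]\<^bsub>G\<^esub> i = t [^]\<^bsub>G\<^esub> (N * (i div N) + i mod N)"
      by simp
    also have "\<dots> = (t [^]\<^bsub>G\<^esub> N) [^]\<^bsub>G\<^esub> (i div N) \<otimes>\<^bsub>G\<^esub> t [^]\<^bsub>G\<^esub> (i mod N)"
      by (simp only: G.nat_pow_mult G.nat_pow_pow \<open>t \<in> carrier G\<close>)
    finally show ?thesis
      by (simp add: tN)
  qed
  obtain u where "g = pres_class (quat_rels n) u"
    using assms by (auto simp: quat_group_def presented_group_carrier)
  with Pw obtain i :: nat where "g = t [^]\<^bsub>G\<^esub> i \<or> g = t [^]\<^bsub>G\<^esub> i \<otimes>\<^bsub>G\<^esub> s"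
    unfolding P_def by blast
  then have "g = t [^]\<^bsub>G\<^esub> (i mod N) \<otimes>\<^bsub>G\<^esub> \<one>\<^bsub>G\<^esub> \<or> g = t [^]\<^bsub>G\<^esub> (i mod N) \<otimes>\<^bsub>G\<^esub> s"
    using red[of i] by auto
  moreover have "i mod N < 2 ^ n"
    unfolding N_def by simp
  ultimately show ?thesis
    using that[of "i mod N" True] that[of "i mod N" False] unfolding G_def s_def t_def by auto
qed

lemma quat_group_order:
  assumes "n \<ge> 2"
  shows "finite (carrier (quat_group n))" "card (carrier (quat_group n)) = 2 ^ (n + 1)"
proof -
  interpret K: group "quat_model n"
    by (rule quat_model_group[OF assms])
  interpret G: group "quat_group n"
    by (rule quat_group_group)
  define nf where "nf = (\<lambda>(i::nat, b). quat_tau n [^]\<^bsub>quat_group n\<^esub> i \<otimes>\<^bsub>quat_group n\<^esub>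
      (if b then quat_sigma n else \<one>\<^bsub>quat_group n\<^esub>))"
  have nf: "carrier (quat_group n) = nf ` ({..<2 ^ n} \<times> UNIV)"
  proof
    show "carrier (quat_group n) \<subseteq> nf ` ({..<2 ^ n} \<times> UNIV)"
    proof
      fix g assume "g \<in> carrier (quat_group n)"
      then obtain i b where "i < 2 ^ n" "g = nf (i, b)"
        unfolding nf_def by (auto elim: quat_normal_form)
      then show "g \<in> nf ` ({..<2 ^ n} \<times> UNIV)"
        by blast
    qed
    show "nf ` ({..<2 ^ n} \<times> UNIV) \<subseteq> carrier (quat_group n)"
      by (auto simp: nf_def quat_sigma_closed quat_tau_closed)
  qed
  define f where "f = case_quat_gen (0::int, True) (1, False)"
  have N: "(2::int) ^ n = 2 * 2 ^ (n - 1)" "(2::int) ^ (n - 1) \<ge> 1"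
    using assms by (cases n; simp)+
  have "(1::int) < 2 ^ n"
    using N by linarith
  then have "f y \<in> carrier (quat_model n)" for y
    by (cases y) (simp_all add: f_def quat_model_def)
  then have f: "range f \<subseteq> carrier (quat_model n)"
    by blast
  have ev: "word_eval (quat_model n) f (replicate m (Gen Tau)) = (int m mod 2 ^ n, False)" for m
    by (induction m) (simp_all add: f_def quat_model_def mod_simps)
  have inv: "inv\<^bsub>quat_model n\<^esub> (0, True) = (2 ^ (n - 1), True)"
    "inv\<^bsub>quat_model n\<^esub> (1, False) = (2 ^ n - 1, False)"
  proof -
    have N': "(2::int) ^ n = 2 * 2 ^ (n - Suc 0)" "(2::int) ^ (n - Suc 0) \<ge> 1"
      using N by (simp_all only: One_nat_def)
    have "(2::int) ^ (n - Suc 0) < 2 ^ n" "(1::int) < 2 ^ n"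
      using N' by linarith+
    then show "inv\<^bsub>quat_model n\<^esub> (0, True) = (2 ^ (n - 1), True)"
      by (intro K.inv_equality) (simp_all add: quat_model_def N'(1))
    show "inv\<^bsub>quat_model n\<^esub> (1, False) = (2 ^ n - 1, False)"
      using \<open>(1::int) < 2 ^ n\<close> by (intro K.inv_equality) (simp_all add: quat_model_def)
  qed
  have one: "\<one>\<^bsub>quat_model n\<^esub> = (0, False)"
    by (simp add: quat_model_def)
  have "word_eval (quat_model n) f u = word_eval (quat_model n) f v"
    if "(u, v) \<in> quat_rels n" for u v
  proof -
    have "(- ((1 + 2 ^ (n - 1) mod 2 ^ n) mod 2 ^ n) + 2 ^ (n - 1)) mod 2 ^ n
        = (- (1 + 2 ^ (n - 1)) + 2 ^ (n - 1) :: int) mod 2 ^ n"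
      by (metis (no_types) mod_add_left_eq mod_add_right_eq mod_minus_eq)
    also have "\<dots> = (2 ^ n - 1) mod 2 ^ n"
      by (simp add: mod_eq_dvd_iff)
    finally have conj: "word_eval (quat_model n) f [Gen Sigma, Gen Tau, Inv Sigma]
        = word_eval (quat_model n) f [Inv Tau]"
      by (simp add: one f_def inv quat_model_mult)
    have "word_eval (quat_model n) f (replicate (2 ^ n) (Gen Tau)) = word_eval (quat_model n) f []"
      by (simp add: ev one)
    moreover have "word_eval (quat_model n) f (replicate (2 ^ (n - 1)) (Gen Tau))
        = word_eval (quat_model n) f [Gen Sigma, Gen Sigma]"
      unfolding ev by (simp add: one f_def quat_model_mult)
    ultimately show ?thesis
      using that conj unfolding quat_rels_def by blast
  qed
  then obtain h where h: "h \<in> hom (quat_group n) (quat_model n)"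
    "\<And>u. h (pres_class (quat_rels n) u) = word_eval (quat_model n) f u"
    unfolding quat_group_def
    using presented_group_universal[OF K.is_group f, of "quat_rels n"] by blast
  interpret h: group_hom "quat_group n" "quat_model n" h
    using h(1) by unfold_locales
  have hs: "h (quat_sigma n) = (0, True)" and ht: "h (quat_tau n [^]\<^bsub>quat_group n\<^esub> i) = (int i mod 2 ^ n, False)" for i
    using N by (simp_all add: quat_sigma_def quat_tau_def quat_class_pow h(2) ev)
      (simp add: f_def quat_model_def)
  have "h (nf (i, b)) = (int i, b)" if "i < 2 ^ n" for i b
  proof -
    have "int i < 2 ^ n"
      using that by (metis of_nat_less_iff of_nat_numeral of_nat_power)
    then show ?thesis
      by (simp add: nf_def quat_sigma_closed quat_tau_closed hs ht quat_model_def)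
  qed
  then have inj: "inj_on nf ({..<2 ^ n} \<times> UNIV)"
    by (auto intro!: inj_onI) (metis of_nat_eq_iff prod.inject)+
  show "finite (carrier (quat_group n))"
    unfolding nf by simp
  show "card (carrier (quat_group n)) = 2 ^ (n + 1)"
    unfolding nf card_image[OF inj] by (simp add: card_cartesian_product)
qed

definition quat_H0 :: "nat \<Rightarrow> quat_gen letter list set set" where
  "quat_H0 n = generate (quat_group n) {quat_tau n}"

definition quat_H1 :: "nat \<Rightarrow> quat_gen letter list set set" where
  "quat_H1 n = generate (quat_group n) {quat_sigma n}"

definition quat_H2 :: "nat \<Rightarrow> quat_gen letter list set set" where
  "quat_H2 n = generate (quat_group n) {quat_sigma n \<otimes>\<^bsub>quat_group n\<^esub> quat_tau n}"

text \<open>Extensionality makes a character determined by its values on the carrier.\<close>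

definition order2_character :: "('a, 'b) monoid_scheme \<Rightarrow> ('a \<Rightarrow> complex) \<Rightarrow> bool" where
  "order2_character G \<chi> \<longleftrightarrow>
     \<chi> \<in> extensional (carrier G) \<and>
     \<chi> ` carrier G \<subseteq> {1, -1} \<and>
     (\<forall>g\<in>carrier G. \<forall>h\<in>carrier G. \<chi> (g \<otimes>\<^bsub>G\<^esub> h) = \<chi> g * \<chi> h) \<and>
     (\<exists>g\<in>carrier G. \<chi> g \<noteq> 1)"

definition quat_char :: "nat \<Rightarrow> quat_gen letter list set set \<Rightarrow> quat_gen letter list set \<Rightarrow> complex" where
  "quat_char n H =
     (THE \<chi>. order2_character (quat_group n) \<chi> \<and> H \<subseteq> {g \<in> carrier (quat_group n). \<chi> g = 1})"

lemma generate_subset_iff: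
  assumes "group G" "subgroup H G"
  shows "generate G S \<subseteq> H \<longleftrightarrow> S \<subseteq> H"
  using group.generate_subgroup_incl[OF assms(1) _ assms(2)] generate.incl[of _ S G] by blast

definition sign_group :: "complex monoid" where
  "sign_group = \<lparr>carrier = {1, -1}, monoid.mult = (*), monoid.one = 1\<rparr>"

lemma sign_group_group: "group sign_group"
  by (rule groupI) (auto simp: sign_group_def)

lemma sign_group_inv:
  assumes "x \<in> {1, -1}"
  shows "inv\<^bsub>sign_group\<^esub> x = x"
proof -
  interpret group sign_group by (rule sign_group_group)
  show ?thesis
    using assms by (intro inv_equality) (auto simp: sign_group_def)
qed

lemma order2_character_hom:
  assumes "order2_character G \<chi>"
  shows "\<chi> \<in> hom G sign_group"
  using assms by (auto simp: order2_character_def hom_def sign_group_def)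

lemma quat_sign_character:
  assumes "n \<ge> 2" "s \<in> {1, -1}" "t \<in> {1, -1}" "s \<noteq> 1 \<or> t \<noteq> 1"
  shows "\<exists>!\<chi>. order2_character (quat_group n) \<chi> \<and> \<chi> (quat_sigma n) = s \<and> \<chi> (quat_tau n) = t"
proof (rule ex_ex1I)
  define f where "f = case_quat_gen s t"
  have f: "range f \<subseteq> carrier sign_group"
    using assms(2,3) by (auto simp: f_def sign_group_def split: quat_gen.split)
  have ev: "word_eval sign_group f (replicate m (Gen Tau)) = t ^ m" for m
    by (induction m) (simp_all add: sign_group_def f_def)
  have t: "t ^ 2 ^ m = 1" if "m \<ge> 1" for m
    using assms(3) that by auto
  have "t ^ 2 ^ n = 1" "t ^ 2 ^ (n - 1) = 1"
    using assms(1) by (auto intro!: t)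
  then have "word_eval sign_group f u = word_eval sign_group f v" if "(u, v) \<in> quat_rels n" for u v
    using that assms(2,3) unfolding quat_rels_def
    by (elim insertE emptyE; clarsimp simp: ev)
      (auto simp: f_def sign_group_inv, auto simp: sign_group_def)
  then obtain h where h: "h \<in> hom (quat_group n) sign_group"
    "\<And>u. h (pres_class (quat_rels n) u) = word_eval sign_group f u"
    unfolding quat_group_def
    using presented_group_universal[OF sign_group_group f, of "quat_rels n"] by blast
  define \<chi> where "\<chi> = restrict h (carrier (quat_group n))"
  have val: "\<chi> (quat_sigma n) = s" "\<chi> (quat_tau n) = t"
    using quat_sigma_closed[of n] quat_tau_closed[of n]
    by (simp_all add: \<chi>_def quat_sigma_def quat_tau_def h(2) f_def) (simp_all add: sign_group_def)
  moreover have "order2_character (quat_group n) \<chi>"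
    unfolding order2_character_def
  proof (intro conjI)
    show "\<chi> \<in> extensional (carrier (quat_group n))"
      by (simp add: \<chi>_def)
    show "\<chi> ` carrier (quat_group n) \<subseteq> {1, -1}"
      using h(1) by (auto simp: \<chi>_def hom_def sign_group_def)
    show "\<forall>g\<in>carrier (quat_group n). \<forall>k\<in>carrier (quat_group n).
        \<chi> (g \<otimes>\<^bsub>quat_group n\<^esub> k) = \<chi> g * \<chi> k"
      using h(1) quat_group_group[of n]
      by (auto simp: \<chi>_def hom_def sign_group_def group.is_monoid monoid.m_closed)
    show "\<exists>g\<in>carrier (quat_group n). \<chi> g \<noteq> 1"
      using assms(4) val quat_sigma_closed[of n] quat_tau_closed[of n] by metis
  qed
  ultimately show "\<exists>\<chi>. order2_character (quat_group n) \<chi> \<and> \<chi> (quat_sigma n) = s \<and> \<chi> (quat_tau n) = t"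
    by blast
next
  fix \<chi> \<psi>
  assume *: "order2_character (quat_group n) \<chi> \<and> \<chi> (quat_sigma n) = s \<and> \<chi> (quat_tau n) = t"
    "order2_character (quat_group n) \<psi> \<and> \<psi> (quat_sigma n) = s \<and> \<psi> (quat_tau n) = t"
  have "\<chi> g = \<psi> g" if "g \<in> carrier (quat_group n)" for g
    using quat_group_hom_ext[OF _ _ sign_group_group _ _ that] * order2_character_hom by metis
  then show "\<chi> = \<psi>"
    using * by (auto simp: order2_character_def intro: extensionalityI)
qed

lemma order2_character_kernel:
  assumes "order2_character (quat_group n) \<chi>" "g \<in> carrier (quat_group n)"
  shows "generate (quat_group n) {g} \<subseteq> {x \<in> carrier (quat_group n). \<chi> x = 1} \<longleftrightarrow> \<chi> g = 1"
proof -
  interpret group_hom "quat_group n" sign_group \<chi>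
    using order2_character_hom[OF assms(1)]
    by (simp add: group_hom_def group_hom_axioms_def quat_group_group sign_group_group)
  have "{x \<in> carrier (quat_group n). \<chi> x = 1} = kernel (quat_group n) sign_group \<chi>"
    by (simp add: kernel_def sign_group_def)
  then have "subgroup {x \<in> carrier (quat_group n). \<chi> x = 1} (quat_group n)"
    by (simp add: subgroup_kernel)
  from generate_subset_iff[OF quat_group_group this] show ?thesis
    using assms(2) by simp
qed

lemma order2_character_nontrivial:
  assumes "order2_character (quat_group n) \<chi>"
  shows "\<chi> (quat_sigma n) \<noteq> 1 \<or> \<chi> (quat_tau n) \<noteq> 1"
proof (rule ccontr)
  assume *: "\<not> ?thesis"
  have triv: "(\<lambda>_. 1) \<in> hom (quat_group n) sign_group"
    by (simp add: hom_def sign_group_def)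
  have "\<chi> g = 1" if "g \<in> carrier (quat_group n)" for g
    using quat_group_hom_ext[OF order2_character_hom[OF assms] triv sign_group_group _ _ that] * by simp
  then show False
    using assms by (auto simp: order2_character_def)
qed

lemma order2_character_values:
  assumes "order2_character (quat_group n) \<chi>"
  shows "\<chi> (quat_sigma n) \<in> {1, -1}" "\<chi> (quat_tau n) \<in> {1, -1}"
    "\<chi> (quat_sigma n \<otimes>\<^bsub>quat_group n\<^esub> quat_tau n) = \<chi> (quat_sigma n) * \<chi> (quat_tau n)"
  using assms quat_sigma_closed[of n] quat_tau_closed[of n]
  by (auto simp: order2_character_def image_subset_iff)

lemma quat_char_ex1:
  assumes "n \<ge> 2" "H \<in> {quat_H0 n, quat_H1 n, quat_H2 n}"
  shows "\<exists>!\<chi>. order2_character (quat_group n) \<chi> \<and> H \<subseteq> {g \<in> carrier (quat_group n). \<chi> g = 1}"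
proof -
  have st: "quat_sigma n \<otimes>\<^bsub>quat_group n\<^esub> quat_tau n \<in> carrier (quat_group n)"
    using quat_group_group[of n] quat_sigma_closed quat_tau_closed
    by (simp add: group.is_monoid monoid.m_closed)
  obtain s t where *: "s \<in> {1, -1}" "t \<in> {1, -1}" "s \<noteq> 1 \<or> t \<noteq> 1"
    "\<And>\<chi>. order2_character (quat_group n) \<chi> \<Longrightarrow>
      H \<subseteq> {g \<in> carrier (quat_group n). \<chi> g = 1} \<longleftrightarrow>
        \<chi> (quat_sigma n) = s \<and> \<chi> (quat_tau n) = t"
  proof -
    note thesis_rule = that
    show ?thesis
      using assms(2)
    proof (elim insertE emptyE)
    assume "H = quat_H0 n"
    have "H \<subseteq> {g \<in> carrier (quat_group n). \<chi> g = 1} \<longleftrightarrow> \<chi> (quat_sigma n) = -1 \<and> \<chi> (quat_tau n) = 1"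
      if "order2_character (quat_group n) \<chi>" for \<chi>
      unfolding \<open>H = quat_H0 n\<close> quat_H0_def order2_character_kernel[OF that quat_tau_closed]
      using order2_character_nontrivial[OF that] order2_character_values[OF that] by auto
    then show ?thesis
      by (intro thesis_rule[of "-1" "1"]) auto
  next
    assume "H = quat_H1 n"
    have "H \<subseteq> {g \<in> carrier (quat_group n). \<chi> g = 1} \<longleftrightarrow> \<chi> (quat_sigma n) = 1 \<and> \<chi> (quat_tau n) = -1"
      if "order2_character (quat_group n) \<chi>" for \<chi>
      unfolding \<open>H = quat_H1 n\<close> quat_H1_def order2_character_kernel[OF that quat_sigma_closed]
      using order2_character_nontrivial[OF that] order2_character_values[OF that] by auto
    then show ?thesis
      by (intro thesis_rule[of "1" "-1"]) auto
  next
    assume "H = quat_H2 n"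
    have "H \<subseteq> {g \<in> carrier (quat_group n). \<chi> g = 1} \<longleftrightarrow> \<chi> (quat_sigma n) = -1 \<and> \<chi> (quat_tau n) = -1"
      if "order2_character (quat_group n) \<chi>" for \<chi>
      unfolding \<open>H = quat_H2 n\<close> quat_H2_def order2_character_kernel[OF that st]
      using order2_character_nontrivial[OF that] order2_character_values[OF that] by auto
    then show ?thesis
      by (intro thesis_rule[of "-1" "-1"]) auto
    qed
  qed
  have "(order2_character (quat_group n) \<chi> \<and> H \<subseteq> {g \<in> carrier (quat_group n). \<chi> g = 1}) \<longleftrightarrow>
      (order2_character (quat_group n) \<chi> \<and> \<chi> (quat_sigma n) = s \<and> \<chi> (quat_tau n) = t)" for \<chi>
    using *(4) by blast
  then show ?thesis
    using quat_sign_character[OF assms(1) *(1-3)] by simp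
qed

lemma quat_char:
  assumes "n \<ge> 2" "H \<in> {quat_H0 n, quat_H1 n, quat_H2 n}"
  shows "order2_character (quat_group n) (quat_char n H)"
    and "H \<subseteq> {g \<in> carrier (quat_group n). quat_char n H g = 1}"
  using theI'[OF quat_char_ex1[OF assms]] by (simp_all add: quat_char_def)

section \<open>Local actions and the Artin character\<close>

text \<open>The group \<open>Aut\<^sub>k(k[[z]])\<close> of \<open>k\<close>-algebra automorphisms.\<close>

definition fps_aut :: "('k::field fps \<Rightarrow> 'k fps) monoid" where
  "fps_aut =
     \<lparr>carrier = {f. bij f \<and> (\<forall>p q. f (p + q) = f p + f q) \<and> (\<forall>p q. f (p * q) = f p * f q) \<and>
                  (\<forall>c. f (fps_const c) = fps_const c)},
      monoid.mult = (\<circ>),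
      monoid.one = id\<rparr>"

definition local_action :: "('a, 'b) monoid_scheme \<Rightarrow> ('a \<Rightarrow> 'k::field fps \<Rightarrow> 'k fps) \<Rightarrow> bool" where
  "local_action G \<phi> \<longleftrightarrow> \<phi> \<in> hom G fps_aut \<and> inj_on \<phi> (carrier G)"

text \<open>
  For a local action and \<open>g \<noteq> 1\<close> the series \<open>g(z) - z\<close> is nonzero, since automorphisms of \<open>k[[z]]\<close>
  preserve the \<open>z\<close>-adic topology and are thus determined by the image of \<open>z\<close>; so the convention
  \<open>subdegree 0 = 0\<close> plays no role.
\<close>

definition artin_char :: "('a, 'b) monoid_scheme \<Rightarrow> ('a \<Rightarrow> 'k::field fps \<Rightarrow> 'k fps) \<Rightarrow> 'a \<Rightarrow> int" where
  "artin_char G \<phi> g =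
     (let a = \<lambda>h. - int (subdegree (\<phi> h fps_X - fps_X))
      in if g = \<one>\<^bsub>G\<^esub> then - (\<Sum>h\<in>carrier G - {\<one>\<^bsub>G\<^esub>}. a h) else a g)"

definition artin_mult ::
    "('a, 'b) monoid_scheme \<Rightarrow> ('a \<Rightarrow> 'k::field fps \<Rightarrow> 'k fps) \<Rightarrow> ('a \<Rightarrow> complex) \<Rightarrow> complex" where
  "artin_mult G \<phi> \<chi> = (\<Sum>g\<in>carrier G. cnj (\<chi> g) * of_int (artin_char G \<phi> g)) / of_nat (Coset.order G)"

text \<open>
  The order on \<open>complex\<close> is that of \<open>HOL-Library.Complex_Order\<close>:
  \<open>2 \<le> w\<close> says that \<open>w\<close> is real and at least 2.
\<close>

definition simple_local_action ::
    "nat \<Rightarrow> (quat_gen letter list set \<Rightarrow> 'k::field fps \<Rightarrow> 'k fps) \<Rightarrow> bool" where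
  "simple_local_action n \<phi> \<longleftrightarrow>
     local_action (quat_group n) \<phi> \<and>
     artin_mult (quat_group n) \<phi> (quat_char n (quat_H0 n)) = 2 \<and>
     artin_mult (quat_group n) \<phi> (quat_char n (quat_H1 n)) =
       artin_mult (quat_group n) \<phi> (quat_char n (quat_H2 n)) \<and>
     2 \<le> artin_mult (quat_group n) \<phi> (quat_char n (quat_H2 n))"

end

theory Submission
  imports Defs
begin

text \<open>
  An action of \<open>G\<close> on \<open>k[[z]]\<close> is encoded by the series \<open>s g = g(z)\<close>, so that \<open>s (g h) = s h \<circ> s g\<close>;
  it need not be faithful. The additive action \<open>1/z \<mapsto> 1/z + l(g)\<close> of the Klein four group
  \<open>G / \<langle>\<tau>\<^sup>2\<rangle>\<close> has \<open>ord (g(z) - z) = 2\<close> for all \<open>g\<close> acting nontrivially. An action with kernel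
  \<open>\<langle>\<tau>\<^bsup>2^j\<^esup>\<rangle>\<close> lifts to a quadratic extension with kernel \<open>\<langle>\<tau>\<^bsup>2^(j+1)\<^esup>\<rangle>\<close>: as \<open>H\<^sup>2\<close> with values in
  \<open>k((z))\<close> vanishes, the quotient of the two kernels extends to a cocycle \<open>c : G \<rightarrow> k((z))\<close>, its
  image under \<open>x \<mapsto> x\<^sup>2 + x\<close> is the coboundary of some \<open>u\<close>, and \<open>G\<close> acts on a root \<open>W\<close> of
  \<open>W\<^sup>2 + W = u\<close> by \<open>g(W) = W + c(g)\<close>. The numbers \<open>ord (g(z) - z)\<close> of the two lifts of a nontrivial
  automorphism add up to twice the number below, so the conductors of the three quadratic characters
  keep the value 2 up to the faithful action at the top.
\<close>

section \<open>Power series over a field\<close>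

lemma fps_X_power_dvd_iff:
  fixes f :: "'a::field fps"
  shows "fps_X ^ n dvd f \<longleftrightarrow> (\<forall>m<n. f $ m = 0)"
proof (cases "f = 0")
  case False
  then have "fps_X ^ n dvd f \<longleftrightarrow> n \<le> subdegree f"
    by (simp add: fps_dvd_iff)
  also have "\<dots> \<longleftrightarrow> (\<forall>m<n. f $ m = 0)"
    using False by (meson nth_less_subdegree_zero order_less_le_trans subdegree_geI)
  finally show ?thesis .
qed simp

text \<open>Banach's fixed point theorem for the X-adic metric on the series with constant term
  \<open>a\<close>: every application of \<open>F\<close> gains one order of agreement, so the
  iterates of \<open>fps_const a\<close> converge.\<close>

lemma fps_fixpoint:
  fixes F :: "'a::field fps \<Rightarrow> 'a fps"
  assumes base: "\<And>f. f $ 0 = a \<Longrightarrow> F f $ 0 = a"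
    and contr: "\<And>f g n. f $ 0 = a \<Longrightarrow> g $ 0 = a \<Longrightarrow> fps_X ^ n dvd f - g \<Longrightarrow> fps_X ^ Suc n dvd F f - F g"
  obtains f where "f $ 0 = a" "F f = f"
proof
  define S where "S i = (F ^^ i) (fps_const a)" for i
  \<comment> \<open>The coefficient of index \<open>n\<close> no longer changes from the
    \<open>n\<close>-th iterate on, so the diagonal is the limit.\<close>
  define f where "f = Abs_fps (\<lambda>n. S n $ n)"
  have S0: "S i $ 0 = a" for i
    by (induction i) (simp_all add: S_def base)
  have step: "fps_X ^ Suc i dvd S (Suc i) - S i" for i
  proof (induction i)
    case 0
    show ?case
      using S0[of 0] S0[of 1] by (subst fps_X_power_dvd_iff) simp
  next
    case (Suc i)
    then show ?case
      using contr[OF S0 S0 Suc] by (simp add: S_def)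
  qed
  have stable: "S (n + j) $ n = S n $ n" for n j
  proof (induction j)
    case (Suc j)
    have "(S (Suc (n + j)) - S (n + j)) $ n = 0"
      using step[of "n + j"] unfolding fps_X_power_dvd_iff by simp
    then show ?case
      using Suc by simp
  qed simp
  have close: "fps_X ^ Suc n dvd f - S n" for n
    unfolding fps_X_power_dvd_iff
  proof (intro allI impI)
    fix m assume "m < Suc n"
    then show "(f - S n) $ m = 0"
      using stable[of m "n - m"] by (simp add: f_def)
  qed
  show f0: "f $ 0 = a"
    by (simp add: f_def S_def)
  have "fps_X ^ Suc (Suc n) dvd F f - f" for n
  proof -
    have "fps_X ^ Suc (Suc n) dvd F f - S (Suc n)"
      using contr[OF f0 S0 close] by (simp add: S_def)
    from dvd_diff[OF this close[of "Suc n"]] show ?thesis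
      by simp
  qed
  then have "(F f - f) $ n = 0" for n
    unfolding fps_X_power_dvd_iff by (metis lessI less_Suc_eq)
  then show "F f = f"
    by (simp add: fps_eq_iff)
qed

lemma diff_dvd_power_diff:
  fixes x y :: "'a::comm_ring_1"
  shows "x - y dvd x ^ n - y ^ n"
  by (simp add: power_diff_sumr2)

text \<open>A coefficient of index \<open>m\<close> of a composition is a finite combination of
  coefficients of index \<open>m\<close> of powers, and \<open>f - g\<close> divides
  \<open>f ^ i - g ^ i\<close>.\<close>

lemma fps_compose_diff_dvd:
  fixes r :: "'a::field fps"
  assumes "fps_X ^ n dvd f - g"
  shows "fps_X ^ n dvd (r oo f) - (r oo g)"
  unfolding fps_X_power_dvd_iff
proof (intro allI impI)
  fix m assume m: "m < n"
  have "fps_X ^ n dvd f ^ i - g ^ i" for i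
    using assms diff_dvd_power_diff dvd_trans by blast
  then have "f ^ i $ m = g ^ i $ m" for i
    using m unfolding fps_X_power_dvd_iff by simp
  then show "((r oo f) - (r oo g)) $ m = 0"
    by (simp add: fps_compose_nth)
qed

section \<open>Equations that perturb a parameter\<close>

text \<open>For a parameter \<open>p\<close> and \<open>a > 0\<close>, the map \<open>f \<mapsto> p(f) + y f\<^sup>a\<close> is the linear map
  \<open>f \<mapsto> p'(0) f\<close> up to a contraction.\<close>

lemma perturbed_parameter_contr:
  fixes p y f g :: "'a::field fps" and a :: nat
  defines "E \<equiv> \<lambda>f. (p oo f) + y * f ^ a - fps_const (p $ 1) * f"
  assumes "p $ 0 = 0" "y $ 0 = 0" "f $ 0 = 0" "g $ 0 = 0" "fps_X ^ n dvd f - g"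
  shows "fps_X ^ Suc n dvd E f - E g"
proof -
  \<comment> \<open>\<open>r\<close> collects what follows the linear term of \<open>p\<close>, so
    that \<open>E h = h^2 r(h) + y h^a\<close> for \<open>h\<close> without constant term.\<close>
  define r where "r = fps_shift 2 p"
  have p: "p = fps_const (p $ 1) * fps_X + fps_X ^ 2 * r"
  proof (rule fps_ext)
    fix n :: nat
    consider "n = 0" | "n = 1" | k where "n = Suc (Suc k)"
      by (metis One_nat_def not0_implies_Suc)
    then show "p $ n = (fps_const (p $ 1) * fps_X + fps_X ^ 2 * r) $ n"
      using assms(2) by cases (simp_all add: r_def fps_X_power_mult_nth)
  qed
  have E: "E h = h ^ 2 * (r oo h) + y * h ^ a" if "h $ 0 = 0" for h
  proof -
    have "p oo h = fps_const (p $ 1) * h + h ^ 2 * (r oo h)"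
      by (subst p) (use that in \<open>simp add: fps_compose_add_distrib fps_compose_mult_distrib fps_compose_power[symmetric]\<close>)
    then show ?thesis
      by (simp add: E_def)
  qed
  have X: "fps_X dvd h" if "h $ 0 = 0" for h :: "'a fps"
    using fps_X_power_dvd_iff[of 1 h] that by simp
  \<comment> \<open>In each of the three summands one difference contributes the order
    \<open>n\<close>, and a further factor without constant term contributes the missing
    one.\<close>
  have "E f - E g = (f - g) * ((f + g) * (r oo f)) + g ^ 2 * ((r oo f) - (r oo g)) + y * (f ^ a - g ^ a)"
    unfolding E[OF assms(4)] E[OF assms(5)] by (simp add: algebra_simps power2_eq_square)
  moreover have "fps_X ^ n * fps_X dvd (f - g) * ((f + g) * (r oo f))"
    using assms by (intro mult_dvd_mono dvd_mult2 X) auto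
  moreover have "fps_X ^ n * fps_X dvd ((r oo f) - (r oo g)) * g ^ 2"
    using assms by (intro mult_dvd_mono fps_compose_diff_dvd X) auto
  moreover have "fps_X ^ n * fps_X dvd (f ^ a - g ^ a) * y"
    using assms by (intro mult_dvd_mono X dvd_trans[OF assms(6) diff_dvd_power_diff]) auto
  ultimately show ?thesis
    by (simp add: mult.commute)
qed

text \<open>For distinct \<open>f\<close> and \<open>g\<close> the difference of the values is
  \<open>p $ 1\<close> times \<open>f - g\<close> plus a term of strictly larger order, so the
  leading term cannot cancel. Injectivity later identifies solutions of such an equation; the
  equality of orders measures ramification.\<close>

lemma perturbed_parameter_subdegree:
  fixes p y f g :: "'a::field fps" and a :: nat
  assumes "p $ 0 = 0" "p $ 1 \<noteq> 0" "y $ 0 = 0" "f $ 0 = 0" "g $ 0 = 0"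
  shows "subdegree ((p oo f) + y * f ^ a - ((p oo g) + y * g ^ a)) = subdegree (f - g)"
    and "(p oo f) + y * f ^ a = (p oo g) + y * g ^ a \<longleftrightarrow> f = g"
proof -
  define n where "n = subdegree (f - g)"
  define E where "E h = (p oo h) + y * h ^ a - fps_const (p $ 1) * h" for h
  have "fps_X ^ n dvd f - g"
    unfolding fps_X_power_dvd_iff n_def using nth_less_subdegree_zero by blast
  then have "fps_X ^ Suc n dvd E f - E g"
    unfolding E_def by (rule perturbed_parameter_contr[OF assms(1,3-5)])
  then have E0: "(E f - E g) $ m = 0" if "m < Suc n" for m
    using that unfolding fps_X_power_dvd_iff by blast
  define D where "D = (p oo f) + y * f ^ a - ((p oo g) + y * g ^ a)"
  have D: "D = fps_const (p $ 1) * (f - g) + (E f - E g)"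
    by (simp add: D_def E_def algebra_simps)
  have "subdegree D = subdegree (f - g) \<and> (D = 0 \<longleftrightarrow> f = g)"
  proof (cases "f = g")
    case False
    then have "(f - g) $ n \<noteq> 0"
      unfolding n_def by (intro nth_subdegree_nonzero) simp
    then have "D $ n \<noteq> 0"
      unfolding D using E0[of n] assms(2) by (simp add: fps_mult_left_const_nth)
    moreover have "D $ m = 0" if "m < n" for m
      unfolding D using E0[of m] that nth_less_subdegree_zero[of m "f - g"] by (simp add: n_def)
    ultimately show ?thesis
      using False by (auto simp: n_def intro!: subdegreeI)
  qed (simp add: D_def)
  then show "subdegree ((p oo f) + y * f ^ a - ((p oo g) + y * g ^ a)) = subdegree (f - g)"
    and "(p oo f) + y * f ^ a = (p oo g) + y * g ^ a \<longleftrightarrow> f = g"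
    unfolding D_def by auto
qed

text \<open>Solving for the linear term gives the fixed point problem
  \<open>h = (w - E h) / p $ 1\<close>, whose right side is a contraction.\<close>

lemma perturbed_parameter_solution:
  fixes p y w :: "'a::field fps" and a :: nat
  assumes "p $ 0 = 0" "p $ 1 \<noteq> 0" "y $ 0 = 0" "w $ 0 = 0" "a > 0"
  obtains f where "f $ 0 = 0" "(p oo f) + y * f ^ a = w"
proof -
  define E where "E h = (p oo h) + y * h ^ a - fps_const (p $ 1) * h" for h
  define F where "F h = fps_const (inverse (p $ 1)) * (w - E h)" for h
  have "F h $ 0 = 0" if "h $ 0 = 0" for h
    using assms that by (simp add: F_def E_def)
  moreover have "fps_X ^ Suc n dvd F f - F g"
    if "f $ 0 = 0" "g $ 0 = 0" "fps_X ^ n dvd f - g" for f g n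
  proof -
    have "fps_X ^ Suc n dvd E g - E f"
      unfolding E_def using assms that by (intro perturbed_parameter_contr) (auto simp: dvd_diff_commute)
    moreover have "F f - F g = fps_const (inverse (p $ 1)) * (E g - E f)"
      by (simp add: F_def algebra_simps)
    ultimately show ?thesis
      by simp
  qed
  ultimately obtain f where f: "f $ 0 = 0" "F f = f"
    using fps_fixpoint[of 0 F] by blast
  have "fps_const (p $ 1) * f = w - E f"
    using assms(2) by (subst f(2)[symmetric]) (simp add: F_def mult.assoc[symmetric] del: One_nat_def)
  then show ?thesis
    using that[OF f(1)] by (simp add: E_def algebra_simps)
qed

section \<open>Artin--Schreier reduction\<close>

lemma char2_add_self:
  fixes x :: "'a::comm_ring_1"
  assumes "CHAR('a) = 2"
  shows "x + x = 0"
  using minus_CHAR_2[OF assms, of x x] by simp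

definition artin_schreier :: "'a::comm_ring_1 \<Rightarrow> 'a" where
  "artin_schreier x = x ^ 2 + x"

lemma artin_schreier_add:
  fixes x y :: "'a::comm_ring_1"
  assumes "CHAR('a) = 2"
  shows "artin_schreier (x + y) = artin_schreier x + artin_schreier y"
proof -
  have "(x + y) ^ 2 = x ^ 2 + y ^ 2 + (x * y + x * y)"
    by (simp add: power2_eq_square algebra_simps)
  then show ?thesis
    unfolding artin_schreier_def char2_add_self[OF assms] by (simp add: algebra_simps)
qed

lemma artin_schreier_eq_0_iff:
  fixes x :: "'a::idom"
  assumes "CHAR('a) = 2"
  shows "artin_schreier x = 0 \<longleftrightarrow> x \<in> {0, 1}"
proof -
  have "artin_schreier x = x * (x + 1)"
    by (simp add: artin_schreier_def power2_eq_square algebra_simps)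
  moreover have "x + 1 = 0 \<longleftrightarrow> x = 1"
    using minus_CHAR_2[OF assms, of x 1] by (metis eq_iff_diff_eq_0)
  ultimately show ?thesis
    by simp
qed

text \<open>A root of \<open>a^2 + a = f $ 0\<close> supplies the constant term. The rest is the
  fixed point of \<open>v \<mapsto> f + v^2\<close>, a contraction because
  \<open>v^2 - w^2 = (v - w)(v + w)\<close> and \<open>v + w\<close> has constant term
  \<open>2a = 0\<close>.\<close>

lemma artin_schreier_surj_fps:
  fixes f :: "'a::alg_closed_field fps"
  assumes "CHAR('a) = 2"
  obtains v where "artin_schreier v = f"
proof -
  have "degree [:- (f $ 0), 1, 1:] > 0"
    by simp
  then obtain a where "poly [:- (f $ 0), 1, 1:] a = 0"
    using alg_closed_imp_poly_has_root by blast
  then have a: "a ^ 2 + a = f $ 0"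
    by (simp add: power2_eq_square algebra_simps)
  have CF: "CHAR('a fps) = 2"
    using assms by simp
  define F where "F v = f + v ^ 2" for v
  have "F v $ 0 = a" if "v $ 0 = a" for v
  proof -
    have "F v $ 0 = a ^ 2 + a + a ^ 2"
      using that a by (simp add: F_def power2_eq_square)
    then show ?thesis
      using char2_add_self[OF assms, of "a ^ 2"] by (simp add: algebra_simps)
  qed
  moreover have "fps_X ^ Suc n dvd F v - F w"
    if vw: "v $ 0 = a" "w $ 0 = a" "fps_X ^ n dvd v - w" for v w n
  proof -
    have "F v - F w = (v - w) * (v + w)"
      by (simp add: F_def algebra_simps power2_eq_square)
    moreover have "fps_X ^ 1 dvd v + w"
      unfolding fps_X_power_dvd_iff using char2_add_self[OF assms, of a] vw by simp
    ultimately show ?thesis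
      using mult_dvd_mono[OF vw(3), of fps_X "v + w"] by (simp add: mult.commute)
  qed
  ultimately obtain v where "v $ 0 = a" "F v = v"
    using fps_fixpoint[of a F] by blast
  then have v: "f + v ^ 2 = v"
    by (simp add: F_def)
  have "artin_schreier v = v ^ 2 + (f + v ^ 2)"
    unfolding artin_schreier_def v ..
  also have "\<dots> = f + (v ^ 2 + v ^ 2)"
    by (rule add.left_commute)
  finally have "artin_schreier v = f + (v ^ 2 + v ^ 2)" .
  then show ?thesis
    using that char2_add_self[OF CF] by simp
qed

lemma fls_nonneg_subdegree:
  fixes f :: "'a::field fls"
  assumes "fls_subdegree f \<ge> 0"
  obtains g where "f = fps_to_fls g"
  using assms that[of "fls_regpart f"] fls_regpart_to_fls_trivial by metis

text \<open>Modulo the image of the Artin-Schreier map, a leading term \<open>b^2 z^(-2d)\<close>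
  can be traded for \<open>b z^(-d)\<close>, which lowers the pole order. This ends at an odd pole
  order or at a power series, which is itself in the image.\<close>

lemma artin_schreier_reduction:
  fixes u :: "'a::alg_closed_field fls"
  assumes "CHAR('a) = 2"
  obtains v where "u + artin_schreier v = 0 \<or> (\<exists>d>0. fls_subdegree (u + artin_schreier v) = 1 - 2 * int d)"
proof -
  have CF: "CHAR('a fls) = 2"
    using assms by simp
  have "\<exists>v. u + artin_schreier v = 0 \<or> (\<exists>d>0. fls_subdegree (u + artin_schreier v) = 1 - 2 * int d)"
    for u :: "'a fls"
  proof (induction "nat (- fls_subdegree u)" arbitrary: u rule: less_induct)
    case less
    define n where "n = fls_subdegree u"
    consider "n \<ge> 0" | "n < 0" "odd n" | "n < 0" "even n"
      by linarith
    then show ?case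
    proof cases
      \<comment> \<open>The series \<open>u = 0\<close> belongs to this case, as
        \<open>fls_subdegree 0 = 0\<close>.\<close>
      case 1
      then obtain f where "u = fps_to_fls f"
        using fls_nonneg_subdegree n_def by blast
      moreover obtain v where "artin_schreier v = f"
        using artin_schreier_surj_fps[OF assms] .
      ultimately have "u = artin_schreier (fps_to_fls v)"
        by (auto simp: artin_schreier_def fps_to_fls_power)
      then have "u + artin_schreier (fps_to_fls v) = 0"
        using char2_add_self[OF CF, of u] by simp
      then show ?thesis
        by blast
    next
      case 2
      then obtain k where "n = 2 * k + 1" "k < 0"
        by (elim oddE) simp
      then have "n = 1 - 2 * int (nat (- k))" "nat (- k) > 0"
        by simp_all
      moreover have "u + artin_schreier 0 = u"
        by (simp add: artin_schreier_def)
      ultimately show ?thesis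
        unfolding n_def by metis
    next
      case 3
      then obtain k where "n = 2 * k" "k < 0"
        by (elim evenE) simp
      moreover define d where "d = nat (- k)"
      ultimately have d: "n = - 2 * int d" "d > 0"
        by simp_all
      \<comment> \<open>\<open>w\<close> is a square root of the leading term of \<open>u\<close>:
        adding \<open>w^2\<close> cancels that term in characteristic 2, while \<open>w\<close> has
        a pole of order only \<open>d < 2d\<close>.\<close>
      obtain b where b: "b ^ 2 = fls_nth u n"
        using nth_root_exists[of 2 "fls_nth u n"] by (auto simp del: One_nat_def)
      define w where "w = fls_const b * fls_X_intpow (- int d)"
      have w2: "w ^ 2 = fls_const (fls_nth u n) * fls_X_intpow n"
        unfolding w_def power_mult_distrib fls_const_power[symmetric] b fls_X_intpow_power d(1) by simp
      define u' where "u' = u + artin_schreier w"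
      have low: "fls_nth u' m = 0" if "m \<le> n" for m
      proof -
        have "fls_nth w m = 0"
          using that d by (simp add: w_def)
        moreover have "fls_nth u m + fls_nth (w ^ 2) m = 0"
          using that char2_add_self[OF assms, of "fls_nth u n"] unfolding w2 by (cases "m = n") (auto simp: n_def)
        ultimately show ?thesis
          by (simp add: u'_def artin_schreier_def add.assoc[symmetric])
      qed
      show ?thesis
      proof (cases "u' = 0")
        case True
        then show ?thesis
          unfolding u'_def by blast
      next
        case False
        then have "n < fls_subdegree u'"
          using low by (intro fls_subdegree_greaterI) auto
        then have "nat (- fls_subdegree u') < nat (- fls_subdegree u)"
          using 3 unfolding n_def by linarith
        from less[OF this] obtain v where
          "u' + artin_schreier v = 0 \<or> (\<exists>d>0. fls_subdegree (u' + artin_schreier v) = 1 - 2 * int d)"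
          by blast
        moreover have "u' + artin_schreier v = u + artin_schreier (w + v)"
          unfolding u'_def artin_schreier_add[OF CF] by (simp add: add.assoc)
        ultimately show ?thesis
          by auto
      qed
    qed
  qed
  then show ?thesis
    using that by blast
qed

section \<open>Group actions by substitution\<close>

text \<open>Dedekind's independence of characters. Comparing the relation at \<open>f\<close> and at \<open>f X\<close>
  eliminates one term.\<close>

lemma substitutions_independent:
  fixes a :: "'k::field fps \<Rightarrow> 'k fls"
  assumes "finite R" "\<And>r. r \<in> R \<Longrightarrow> r \<noteq> 0 \<and> r $ 0 = 0"
    and "\<And>f. (\<Sum>r\<in>R. a r * fls_compose_fps f r) = 0" "r \<in> R"
  shows "a r = 0"
  using assms
proof (induction R arbitrary: a r rule: finite_induct)
  case (insert r0 R)
  have rel: "a r0 * fls_compose_fps f r0 + (\<Sum>r\<in>R. a r * fls_compose_fps f r) = 0" for f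
    using insert.prems(2)[of f] insert.hyps by simp
  have "(\<Sum>r\<in>R. (a r * (fps_to_fls r - fps_to_fls r0)) * fls_compose_fps f r) = 0" for f
  proof -
    have X: "fls_compose_fps (f * fls_X) r = fls_compose_fps f r * fps_to_fls r" if "r \<in> insert r0 R" for r
      using insert.prems(1)[OF that] by (simp add: fls_compose_fps_mult)
    have "(\<Sum>r\<in>R. (a r * (fps_to_fls r - fps_to_fls r0)) * fls_compose_fps f r)
        = (\<Sum>r\<in>R. a r * fls_compose_fps (f * fls_X) r) - fps_to_fls r0 * (\<Sum>r\<in>R. a r * fls_compose_fps f r)"
      unfolding sum_distrib_left sum_subtractf[symmetric]
      by (intro sum.cong refl) (simp only: X insertI2, simp add: algebra_simps)
    also have "(\<Sum>r\<in>R. a r * fls_compose_fps f r) = - (a r0 * fls_compose_fps f r0)"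
      using rel[of f] by (simp add: eq_neg_iff_add_eq_0 add.commute)
    also have "(\<Sum>r\<in>R. a r * fls_compose_fps (f * fls_X) r) = - (a r0 * fls_compose_fps (f * fls_X) r0)"
      using rel[of "f * fls_X"] by (simp add: eq_neg_iff_add_eq_0 add.commute)
    finally show ?thesis
      by (simp add: X)
  qed
  then have "a r * (fps_to_fls r - fps_to_fls r0) = 0" if "r \<in> R" for r
    using insert.IH[of "\<lambda>r. a r * (fps_to_fls r - fps_to_fls r0)"] insert.prems(1) that by blast
  then have *: "a r = 0" if "r \<in> R" for r
    using that insert.hyps by fastforce
  with rel[of 1] have "a r0 = 0"
    by simp
  with * insert.prems(3) show ?case
    by blast
qed simp

locale series_action = group G for G (structure) +
  fixes s :: "'a \<Rightarrow> 'k::field fps"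
  assumes s_nth_0: "g \<in> carrier G \<Longrightarrow> s g $ 0 = 0"
    and s_one: "s \<one> = fps_X"
    and s_mult: "g \<in> carrier G \<Longrightarrow> h \<in> carrier G \<Longrightarrow> s (g \<otimes> h) = s h oo s g"
begin

definition act :: "'a \<Rightarrow> 'k fls \<Rightarrow> 'k fls" where
  "act g f = fls_compose_fps f (s g)"

definition act_ker :: "'a set" where
  "act_ker = {g \<in> carrier G. s g = fps_X}"

text \<open>The image of \<open>s\<close> is a model of the quotient of \<open>G\<close> by
  \<open>act_ker\<close>, and \<open>rep\<close> chooses a representative of each coset. Sums over
  the image of \<open>s\<close> are thus sums over this quotient.\<close>

definition rep :: "'k fps \<Rightarrow> 'a" where
  "rep = inv_into (carrier G) s"

text \<open>Composing \<open>s (inv g)\<close> with \<open>s g\<close> gives \<open>fps_X\<close>,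
  whereas composing with 0 gives a constant.\<close>

lemma s_nonzero: "g \<in> carrier G \<Longrightarrow> s g \<noteq> 0"
proof
  assume g: "g \<in> carrier G" "s g = 0"
  then have "fps_X = s (inv g) oo 0"
    using s_mult[of g "inv g"] s_one by simp
  then have "fps_X $ 1 = (s (inv g) oo 0) $ 1"
    by metis
  then show False
    by simp
qed

lemma mult_inv_mult: "x \<in> carrier G \<Longrightarrow> y \<in> carrier G \<Longrightarrow> x \<otimes> (inv x \<otimes> y) = y"
  by (simp flip: m_assoc)

lemma act_add: "g \<in> carrier G \<Longrightarrow> act g (x + y) = act g x + act g y"
  and act_mult: "g \<in> carrier G \<Longrightarrow> act g (x * y) = act g x * act g y"
  and act_power: "g \<in> carrier G \<Longrightarrow> act g (x ^ n) = act g x ^ n"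
  and act_inverse: "g \<in> carrier G \<Longrightarrow> act g (inverse x) = inverse (act g x)"
  and act_zero [simp]: "act g 0 = 0"
  and act_1 [simp]: "act g 1 = 1"
  by (simp_all add: act_def s_nonzero s_nth_0 fls_compose_fps_add fls_compose_fps_mult
      fls_compose_fps_power fls_compose_fps_inverse)

lemma act_of_bool: "act g (of_bool b) = of_bool b"
  by (cases b) simp_all

lemma act_sum: "g \<in> carrier G \<Longrightarrow> act g (sum f A) = (\<Sum>x\<in>A. act g (f x))"
  by (induction A rule: infinite_finite_induct) (simp_all add: act_add)

lemma act_artin_schreier: "g \<in> carrier G \<Longrightarrow> act g (artin_schreier x) = artin_schreier (act g x)"
  by (simp add: artin_schreier_def act_add act_power)

lemma act_act: "g \<in> carrier G \<Longrightarrow> h \<in> carrier G \<Longrightarrow> act (g \<otimes> h) x = act g (act h x)"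
  by (simp add: act_def s_mult fls_compose_fps_assoc s_nonzero s_nth_0)

lemma s_mult_cong:
  assumes "s x = s y" "x \<in> carrier G" "y \<in> carrier G" "g \<in> carrier G"
  shows "s (g \<otimes> x) = s (g \<otimes> y)"
  using assms by (simp add: s_mult)

lemma s_ker_left: "n \<in> act_ker \<Longrightarrow> g \<in> carrier G \<Longrightarrow> s (n \<otimes> g) = s g"
  and s_ker_right: "n \<in> act_ker \<Longrightarrow> g \<in> carrier G \<Longrightarrow> s (g \<otimes> n) = s g"
  by (simp_all add: act_ker_def s_mult s_nth_0)

lemma act_ker_closed: "n \<in> act_ker \<Longrightarrow> n \<in> carrier G"
  by (simp add: act_ker_def)

lemma act_ker_act: "n \<in> act_ker \<Longrightarrow> act n x = x"
  using fls_nth_fls_compose_fps_linear[of 1 x] by (simp add: act_ker_def act_def fls_eq_iff)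

lemma inv_mult_act_ker:
  assumes "s x = s y" "x \<in> carrier G" "y \<in> carrier G"
  shows "inv x \<otimes> y \<in> act_ker"
  using s_mult_cong[OF assms(1-3), of "inv x"] assms s_one by (simp add: act_ker_def)

lemma rep:
  assumes "r \<in> s ` carrier G"
  shows "rep r \<in> carrier G" "s (rep r) = r"
  using assms by (simp_all add: rep_def inv_into_into f_inv_into_f)

lemma rep_s:
  assumes "g \<in> carrier G"
  shows "rep (s g) \<in> carrier G" "s (rep (s g)) = s g"
  using assms by (auto intro: rep)

text \<open>Left translation by \<open>g\<close> permutes the cosets of \<open>act_ker\<close>, and
  \<open>F\<close> is constant on each coset, so the change of representatives is harmless.\<close>

lemma orbit_sum_shift:
  assumes F: "\<And>x y. x \<in> carrier G \<Longrightarrow> y \<in> carrier G \<Longrightarrow> s x = s y \<Longrightarrow> F x = F y"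
    and g: "g \<in> carrier G"
  shows "(\<Sum>r\<in>s ` carrier G. F (g \<otimes> rep r)) = (\<Sum>r\<in>s ` carrier G. F (rep r))"
proof -
  have shift_back: "s (h \<otimes> rep (s (k \<otimes> rep r))) = r"
    if "r \<in> s ` carrier G" "h \<in> carrier G" "k \<in> carrier G" "h \<otimes> k = \<one>" for r h k
  proof -
    have "s (h \<otimes> rep (s (k \<otimes> rep r))) = s (h \<otimes> (k \<otimes> rep r))"
      using that by (intro s_mult_cong rep_s) (auto simp: rep)
    also have "\<dots> = r"
      using that by (simp add: rep flip: m_assoc)
    finally show ?thesis .
  qed
  show ?thesis
    by (rule sum.reindex_bij_witness[where j = "\<lambda>r. s (g \<otimes> rep r)" and i = "\<lambda>r. s (inv g \<otimes> rep r)"])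
      (use g in \<open>auto simp: rep rep_s shift_back intro!: F\<close>)
qed

text \<open>By independence of distinct substitutions the trace is not identically zero. Traces are
  invariant under \<open>G\<close>, so dividing \<open>x\<close> by its nonzero trace produces trace
  one.\<close>

lemma trace_one:
  assumes "finite (carrier G)"
  obtains \<theta> where "(\<Sum>r\<in>s ` carrier G. act (rep r) \<theta>) = 1"
proof -
  define tr where "tr x = (\<Sum>r\<in>s ` carrier G. act (rep r) x)" for x
  have tr: "tr x = (\<Sum>r\<in>s ` carrier G. fls_compose_fps x r)" for x
    by (simp add: tr_def act_def rep)
  obtain x where x: "tr x \<noteq> 0"
  proof (rule ccontr)
    assume "\<not> thesis"
    then have "tr x = 0" for x
      using that by blast
    then have "(1 :: 'k fls) = 0"
      by (intro substitutions_independent[of "s ` carrier G" "\<lambda>_. 1" "s \<one>"])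
        (use assms in \<open>auto simp: s_nonzero s_nth_0 simp flip: tr\<close>)
    then show False
      by simp
  qed
  have inv: "act g (tr x) = tr x" if "g \<in> carrier G" for g
  proof -
    have "act g (tr x) = (\<Sum>r\<in>s ` carrier G. act (g \<otimes> rep r) x)"
      using that by (simp add: tr_def act_sum act_act rep)
    also have "\<dots> = tr x"
      unfolding tr_def using that by (intro orbit_sum_shift) (simp_all add: act_def)
    finally show ?thesis .
  qed
  have "(\<Sum>r\<in>s ` carrier G. act (rep r) (x * inverse (tr x))) = tr x * inverse (tr x)"
    unfolding tr_def[of x] sum_distrib_right
    by (intro sum.cong refl) (simp add: act_mult act_inverse rep inv flip: tr_def)
  then show ?thesis
    using that x by simp
qed

definition cocycle :: "('a \<Rightarrow> 'k fls) \<Rightarrow> bool" where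
  "cocycle c \<longleftrightarrow> (\<forall>g\<in>carrier G. \<forall>h\<in>carrier G. c (g \<otimes> h) = c g + act g (c h))"

lemma cocycle_mult: "cocycle c \<Longrightarrow> g \<in> carrier G \<Longrightarrow> h \<in> carrier G \<Longrightarrow> c (g \<otimes> h) = c g + act g (c h)"
  by (simp add: cocycle_def)

end

section \<open>Cocycles with values in \<open>k((z))\<close> in characteristic 2\<close>

locale series_action_char2 = series_action G s for G (structure) and s :: "'a \<Rightarrow> 'k::alg_closed_field fps" +
  assumes char2: "CHAR('k) = 2" and fin: "finite (carrier G)"
begin

lemma add_self: "(x :: 'k fls) + x = 0"
  using char2 by (intro char2_add_self) simp

lemma AS_add: "artin_schreier (x + y :: 'k fls) = artin_schreier x + artin_schreier y"
  using char2 by (intro artin_schreier_add) simp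

lemma AS_of_bool: "artin_schreier (of_bool b :: 'k fls) = 0"
  using add_self[of 1] by (cases b) (simp_all add: artin_schreier_def)

text \<open>The homomorphism \<open>act_ker / H \<rightarrow> \<F>\<^sub>2\<close> is transported to a cocycle by means of an
  element of trace one: this is the vanishing of the obstruction in \<open>H\<^sup>2(G / act_ker, k((z)))\<close>.\<close>

lemma cocycle_exists:
  assumes H: "H \<lhd> G" "H \<subseteq> act_ker"
    and index2: "\<And>x y. x \<in> act_ker - H \<Longrightarrow> y \<in> act_ker - H \<Longrightarrow> x \<otimes> y \<in> H"
  obtains c where "cocycle c" "\<And>n. n \<in> act_ker \<Longrightarrow> c n = of_bool (n \<notin> H)"
proof -
  interpret H: normal H G by fact
  obtain \<theta> where \<theta>: "(\<Sum>r\<in>s ` carrier G. act (rep r) \<theta>) = 1"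
    using trace_one[OF fin] .
  \<comment> \<open>\<open>e\<close> is the homomorphism from \<open>act_ker\<close> to {0, 1} with
    kernel \<open>H\<close>, with its values regarded in \<open>k((z))\<close>.\<close>
  define e where "e x = (of_bool (x \<notin> H) :: 'k fls)" for x
  have e_mult: "e (x \<otimes> y) = e x + e y" if xy: "x \<in> act_ker" "y \<in> act_ker" for x y
  proof -
    have cl: "x \<in> carrier G" "y \<in> carrier G"
      using xy act_ker_closed by auto
    have "x \<otimes> y \<in> H \<longleftrightarrow> (x \<in> H \<longleftrightarrow> y \<in> H)"
    proof (cases "x \<in> H"; cases "y \<in> H")
      assume *: "x \<in> H" "y \<notin> H"
      then have "inv x \<otimes> (x \<otimes> y) \<notin> H"
        using cl by (simp flip: m_assoc)
      then show ?thesis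
        using * H.m_closed H.m_inv_closed by blast
    next
      assume *: "x \<notin> H" "y \<in> H"
      then have "(x \<otimes> y) \<otimes> inv y \<notin> H"
        using cl by (simp add: m_assoc)
      then show ?thesis
        using * H.m_closed H.m_inv_closed by blast
    qed (use index2 xy in auto)
    then show ?thesis
      using add_self[of 1] by (auto simp: e_def)
  qed
  have e_conj: "e (inv x \<otimes> n \<otimes> x) = e n" if "x \<in> carrier G" "n \<in> carrier G" for x n
  proof -
    have "n \<in> H" if "inv x \<otimes> n \<otimes> x \<in> H"
    proof -
      have "x \<otimes> (inv x \<otimes> n \<otimes> x) \<otimes> inv x \<in> H"
        using H.inv_op_closed2[OF \<open>x \<in> carrier G\<close> that] .
      also have "x \<otimes> (inv x \<otimes> n \<otimes> x) \<otimes> inv x = n"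
        using \<open>x \<in> carrier G\<close> \<open>n \<in> carrier G\<close> by (simp add: m_assoc mult_inv_mult)
      finally show ?thesis .
    qed
    moreover have "inv x \<otimes> n \<otimes> x \<in> H" if "n \<in> H"
      using H.inv_op_closed1[OF \<open>x \<in> carrier G\<close> that] .
    ultimately show ?thesis
      by (auto simp: e_def)
  qed
  \<comment> \<open>\<open>f\<close> extends \<open>e\<close> to \<open>G\<close> relative to the
    chosen representatives; what is kept of additivity is
    \<open>f (x \<otimes> n) = f x + e n\<close>.\<close>
  define f where "f x = e (inv (rep (s x)) \<otimes> x)" for x
  have f_mult: "f (x \<otimes> n) = f x + e n" if "x \<in> carrier G" "n \<in> act_ker" for x n
  proof -
    have "f (x \<otimes> n) = e ((inv (rep (s x)) \<otimes> x) \<otimes> n)"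
      using that by (simp add: f_def s_ker_right act_ker_closed m_assoc rep_s)
    also have "\<dots> = f x + e n"
      unfolding f_def using that by (intro e_mult inv_mult_act_ker) (simp_all add: rep_s)
    finally show ?thesis .
  qed
  have act_f: "act g (f x) = f x" for g x
    by (simp add: f_def e_def act_of_bool)
  \<comment> \<open>Formally \<open>c\<close> below is the coboundary of the sum of
    \<open>f t * act t \<theta>\<close> over cosets. That sum would depend on the representatives,
    but \<open>f (g \<otimes> t) + f t\<close> does not: along a coset both terms change by the same
    \<open>e n\<close>.\<close>
  define F where "F g t = (f (g \<otimes> t) + f t) * act (g \<otimes> t) \<theta>" for g t
  have F_cong: "F g x = F g y" if "x \<in> carrier G" "y \<in> carrier G" "s x = s y" "g \<in> carrier G" for g x y
  proof -
    define n where "n = inv x \<otimes> y"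
    have n: "n \<in> act_ker" "y = x \<otimes> n"
      using that inv_mult_act_ker[of x y] by (simp_all add: n_def flip: m_assoc)
    have "f (g \<otimes> y) + f y = (f (g \<otimes> x) + e n) + (f x + e n)"
      using that n f_mult[of "g \<otimes> x" n] f_mult[of x n] act_ker_closed[of n] by (simp add: m_assoc)
    also have "\<dots> = f (g \<otimes> x) + f x + (e n + e n)"
      by (simp only: ac_simps)
    finally show ?thesis
      using s_mult_cong[OF that(3,1,2,4)] by (simp add: F_def act_def add_self)
  qed
  define c where "c g = (\<Sum>r\<in>s ` carrier G. F g (rep r))" for g
  have "c (g \<otimes> h) = c g + act g (c h)" if gh: "g \<in> carrier G" "h \<in> carrier G" for g h
  proof -
    \<comment> \<open>The sum telescopes once \<open>f (h \<otimes> t)\<close> is inserted twice,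
      which adds 0.\<close>
    have "F (g \<otimes> h) t = F g (h \<otimes> t) + act g (F h t)" if t: "t \<in> carrier G" for t
    proof -
      have "f (g \<otimes> h \<otimes> t) + f t = f (g \<otimes> (h \<otimes> t)) + f t + (f (h \<otimes> t) + f (h \<otimes> t))"
        using gh t by (simp add: m_assoc add_self)
      also have "\<dots> = (f (g \<otimes> (h \<otimes> t)) + f (h \<otimes> t)) + (f (h \<otimes> t) + f t)"
        by (simp only: ac_simps)
      finally have "F (g \<otimes> h) t = ((f (g \<otimes> (h \<otimes> t)) + f (h \<otimes> t)) + (f (h \<otimes> t) + f t)) * act (g \<otimes> (h \<otimes> t)) \<theta>"
        unfolding F_def using gh t by (simp only: m_assoc)
      moreover have "act g (F h t) = (f (h \<otimes> t) + f t) * act (g \<otimes> (h \<otimes> t)) \<theta>"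
        using gh t by (simp add: F_def act_mult act_add act_f act_act)
      ultimately show ?thesis
        by (simp only: F_def distrib_right)
    qed
    then have "c (g \<otimes> h) = (\<Sum>r\<in>s ` carrier G. F g (h \<otimes> rep r)) + (\<Sum>r\<in>s ` carrier G. act g (F h (rep r)))"
      unfolding c_def sum.distrib[symmetric] by (intro sum.cong refl) (simp add: rep)
    also have "\<dots> = c g + act g (c h)"
      unfolding c_def using gh by (subst orbit_sum_shift) (auto simp: act_sum intro: F_cong)
    finally show ?thesis .
  qed
  then have "cocycle c"
    by (simp add: cocycle_def)
  moreover have "c n = of_bool (n \<notin> H)" if n: "n \<in> act_ker" for n
  proof -
    \<comment> \<open>Moving \<open>n\<close> past \<open>t\<close> conjugates it, which leaves
      \<open>e\<close> unchanged. So the factor is the constant \<open>e n\<close>, and the trace of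
      \<open>\<theta>\<close> is one.\<close>
    have "F n t = e n * act t \<theta>" if t: "t \<in> carrier G" for t
    proof -
      have nc: "n \<in> carrier G"
        using n by (rule act_ker_closed)
      have k: "inv t \<otimes> n \<otimes> t \<in> act_ker"
        using inv_mult_act_ker[of t "n \<otimes> t"] n nc t by (simp add: s_ker_left m_assoc)
      have "n \<otimes> t = t \<otimes> (inv t \<otimes> n \<otimes> t)"
        using nc t by (simp add: m_assoc mult_inv_mult)
      then have "f (n \<otimes> t) = f t + e n"
        using f_mult[OF t k] e_conj[OF t nc] by simp
      then have "f (n \<otimes> t) + f t = e n"
        using add_self[of "f t"] by (simp add: add.commute add.left_commute)
      then show ?thesis
        using s_ker_left[OF n t] by (simp add: F_def act_def)
    qed
    then have "c n = e n * (\<Sum>r\<in>s ` carrier G. act (rep r) \<theta>)"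
      unfolding c_def sum_distrib_left by (intro sum.cong refl) (simp add: rep)
    then show ?thesis
      by (simp add: \<theta> e_def)
  qed
  ultimately show ?thesis
    using that by blast
qed

text \<open>The values of \<open>c\<close> on \<open>act_ker\<close> are 0 and 1, which the
  Artin-Schreier map kills, so \<open>artin_schreier (c g)\<close> depends only on the coset of
  \<open>g\<close>. Averaging it against an element of trace one gives \<open>u\<close>, as in the
  additive form of Hilbert 90.\<close>

lemma artin_schreier_cocycle_coboundary:
  assumes "cocycle c" "\<And>n. n \<in> act_ker \<Longrightarrow> c n = of_bool (P n)"
  obtains u where "\<And>g. g \<in> carrier G \<Longrightarrow> act g u = u + artin_schreier (c g)"
proof -
  obtain \<theta> where \<theta>: "(\<Sum>r\<in>s ` carrier G. act (rep r) \<theta>) = 1"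
    using trace_one[OF fin] .
  define F where "F x = artin_schreier (c x) * act x \<theta>" for x
  have F_cong: "F x = F y" if "x \<in> carrier G" "y \<in> carrier G" "s x = s y" for x y
  proof -
    define n where "n = inv x \<otimes> y"
    have n: "n \<in> act_ker" "y = x \<otimes> n"
      using that inv_mult_act_ker[of x y] by (simp_all add: n_def flip: m_assoc)
    have "c y = c x + of_bool (P n)"
      using that n assms(2)[OF n(1)] cocycle_mult[OF assms(1), of x n] act_ker_closed[of n] act_of_bool by simp
    then show ?thesis
      using that by (simp add: F_def AS_add AS_of_bool act_def)
  qed
  define u where "u = (\<Sum>r\<in>s ` carrier G. F (rep r))"
  have "act g u = u + artin_schreier (c g)" if g: "g \<in> carrier G" for g
  proof -
    have "act g (F t) = F (g \<otimes> t) + artin_schreier (c g) * act (g \<otimes> t) \<theta>" if t: "t \<in> carrier G" for t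
    proof -
      have "artin_schreier (c (g \<otimes> t)) + artin_schreier (c g)
          = act g (artin_schreier (c t)) + (artin_schreier (c g) + artin_schreier (c g))"
        using g t by (simp add: cocycle_mult[OF assms(1)] AS_add act_artin_schreier ac_simps)
      then show ?thesis
        using g t by (simp add: F_def act_mult act_act add_self flip: distrib_right)
    qed
    then have "act g u = (\<Sum>r\<in>s ` carrier G. F (g \<otimes> rep r))
        + artin_schreier (c g) * (\<Sum>r\<in>s ` carrier G. act (g \<otimes> rep r) \<theta>)"
      unfolding u_def act_sum[OF g] sum_distrib_left sum.distrib[symmetric]
      by (intro sum.cong refl) (simp add: rep)
    also have "(\<Sum>r\<in>s ` carrier G. F (g \<otimes> rep r)) = u"
      unfolding u_def using g by (intro orbit_sum_shift F_cong)
    also have "(\<Sum>r\<in>s ` carrier G. act (g \<otimes> rep r) \<theta>) = 1"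
      unfolding \<theta>[symmetric] using g by (intro orbit_sum_shift) (simp_all add: act_def)
    finally show ?thesis
      by simp
  qed
  then show ?thesis
    using that by blast
qed

text \<open>If \<open>u\<close> could be reduced to \<open>0\<close>, then \<open>c\<close> would become a homomorphism to \<open>\<F>\<^sub>2\<close>, which is
  impossible because it does not vanish at the square \<open>\<mu>\<^sup>2\<close>.\<close>

lemma reduced_cocycle_exists:
  assumes H: "H \<lhd> G" "H \<subseteq> act_ker"
    and index2: "\<And>x y. x \<in> act_ker - H \<Longrightarrow> y \<in> act_ker - H \<Longrightarrow> x \<otimes> y \<in> H"
    and \<mu>: "\<mu> \<in> carrier G" "\<mu> \<otimes> \<mu> \<in> act_ker - H"
  obtains c u d where "cocycle c" "\<And>n. n \<in> act_ker \<Longrightarrow> c n = of_bool (n \<notin> H)"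
    "\<And>g. g \<in> carrier G \<Longrightarrow> act g u = u + artin_schreier (c g)"
    "d > 0" "fls_subdegree u = 1 - 2 * int d"
proof -
  obtain c0 where c0: "cocycle c0" "\<And>n. n \<in> act_ker \<Longrightarrow> c0 n = of_bool (n \<notin> H)"
    using cocycle_exists[OF H index2] by blast
  obtain u0 where u0: "\<And>g. g \<in> carrier G \<Longrightarrow> act g u0 = u0 + artin_schreier (c0 g)"
    using artin_schreier_cocycle_coboundary[OF c0] by blast
  obtain v where v: "u0 + artin_schreier v = 0 \<or> (\<exists>d>0. fls_subdegree (u0 + artin_schreier v) = 1 - 2 * int d)"
    using artin_schreier_reduction[OF char2] .
  define u where "u = u0 + artin_schreier v"
  \<comment> \<open>Passing from \<open>u0\<close> to \<open>u\<close> alters the cocycle by the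
    coboundary of \<open>v\<close>, which vanishes on \<open>act_ker\<close>.\<close>
  define c where "c g = c0 g + act g v + v" for g
  have "c (g \<otimes> h) = c g + act g (c h)" if gh: "g \<in> carrier G" "h \<in> carrier G" for g h
  proof -
    have "c g + act g (c h) = c0 g + act g (c0 h) + act g (act h v) + v + (act g v + act g v)"
      unfolding c_def act_add[OF gh(1)] by (simp only: ac_simps)
    then show ?thesis
      using gh by (simp add: c_def add_self cocycle_mult[OF c0(1)] act_act)
  qed
  then have c: "cocycle c"
    by (simp add: cocycle_def)
  have c_ker: "c n = of_bool (n \<notin> H)" if "n \<in> act_ker" for n
    using that by (simp add: c_def c0(2) act_ker_act add_self add.assoc)
  have u: "act g u = u + artin_schreier (c g)" if g: "g \<in> carrier G" for g
  proof -
    have "u + artin_schreier (c g) = u0 + artin_schreier (c0 g) + artin_schreier (act g v)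
        + (artin_schreier v + artin_schreier v)"
      unfolding c_def u_def AS_add by (simp only: ac_simps)
    then show ?thesis
      using g by (simp add: u_def add_self act_add u0 act_artin_schreier)
  qed
  have "u \<noteq> 0"
  proof
    assume "u = 0"
    then have "artin_schreier (c \<mu>) = 0"
      using u[OF \<mu>(1)] by simp
    then have "c \<mu> \<in> {0, 1}"
      using char2 by (subst (asm) artin_schreier_eq_0_iff) simp_all
    then have "c (\<mu> \<otimes> \<mu>) = 0"
      using cocycle_mult[OF c \<mu>(1) \<mu>(1)] add_self[of 1] by auto
    then show False
      using c_ker[of "\<mu> \<otimes> \<mu>"] \<mu>(2) by simp
  qed
  then obtain d where "d > 0" "fls_subdegree u = 1 - 2 * int d"
    using v u_def by auto
  then show ?thesis
    using that c c_ker u by blast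
qed

end

section \<open>Lifting an action to a quadratic extension\<close>

lemma fls_integral_quadratic:
  fixes V :: "'a::field fls"
  assumes eq: "V ^ 2 + fps_to_fls t * V = fps_to_fls q" and "t $ 0 = 0" "q $ 0 = 0"
  shows "\<exists>Y. fps_to_fls Y = V \<and> Y $ 0 = 0"
proof (cases "V = 0")
  case True
  then show ?thesis
    by (intro exI[of _ 0]) simp
next
  case False
  define v where "v = fls_subdegree V"
  \<comment> \<open>If \<open>v\<close> were at most 0, the order \<open>2v\<close> of
    \<open>V^2\<close> would lie strictly below that of the other summand, and the right side would
    have a nonzero coefficient at an index at most 0.\<close>
  have "v > 0"
  proof (rule ccontr)
    assume "\<not> v > 0"
    have "fls_nth (V ^ 2) (2 * v) \<noteq> 0"
      using False nth_fls_subdegree_nonzero[of "V ^ 2"] by (simp add: v_def fls_subdegree_pow)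
    moreover have "fls_nth (fps_to_fls t * V) (2 * v) = 0"
    proof (cases "t = 0")
      case t: False
      then have "subdegree t > 0"
        using assms(2) by (metis gr0I nth_subdegree_nonzero)
      then show ?thesis
        using \<open>\<not> v > 0\<close> by (intro fls_times_nth_eq0) (simp add: fls_subdegree_fls_to_fps v_def)
    qed simp
    ultimately have "fls_nth (fps_to_fls q) (2 * v) \<noteq> 0"
      by (simp flip: eq)
    then show False
      using \<open>\<not> v > 0\<close> assms(3) by (cases "v = 0") auto
  qed
  moreover obtain Y where "V = fps_to_fls Y"
    using fls_nonneg_subdegree[of V] \<open>v > 0\<close> v_def by fastforce
  ultimately show ?thesis
    by (intro exI[of _ Y]) (auto simp: v_def fls_subdegree_fls_to_fps intro: nth_less_subdegree_zero)
qed

context series_action_char2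
begin

text \<open>Adjoin a root \<open>W\<close> of \<open>W\<^sup>2 + W = u\<close> and let \<open>g\<close> send \<open>W\<close> to \<open>W + c g\<close>. With
  \<open>p = z\<^bsup>2d\<^esup> u\<close>, the element \<open>y = z\<^sup>d W\<close> is a uniformizer of the extension, and \<open>z\<close> is recovered from
  \<open>y\<close> as the solution \<open>Z\<close> of \<open>p(Z) + y Z\<^sup>d = y\<^sup>2\<close>.\<close>

lemma quadratic_lift:
  assumes c: "cocycle c" and u: "\<And>g. g \<in> carrier G \<Longrightarrow> act g u = u + artin_schreier (c g)"
    and d: "d > 0" "fls_subdegree u = 1 - 2 * int d"
  obtains Y :: "'a \<Rightarrow> 'k fps" where "series_action G Y"
    and "{g \<in> carrier G. Y g = fps_X} = {g \<in> act_ker. c g = 0}"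
    and "\<And>g \<nu>. g \<in> carrier G - act_ker \<Longrightarrow> \<nu> \<in> act_ker \<Longrightarrow> c \<nu> = 1 \<Longrightarrow>
      subdegree (Y g - fps_X) + subdegree (Y (g \<otimes> \<nu>) - fps_X) = 2 * subdegree (s g - fps_X)"
proof -
  \<comment> \<open>As \<open>u\<close> has a pole of order \<open>2d - 1\<close>, the order of
    \<open>p\<close> is exactly 1.\<close>
  define p where "p = fls_regpart (u * fls_X ^ (2 * d))"
  have u0: "u \<noteq> 0"
    using d by auto
  have "fls_subdegree (u * fls_X ^ (2 * d)) = 1"
    using u0 d by simp
  then have p: "fps_to_fls p = u * fls_X ^ (2 * d)" "subdegree p = 1"
    unfolding p_def by (simp_all add: fls_regpart_to_fls_trivial fls_regpart_subdegree_conv)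
  have p01: "p $ 0 = 0" "p $ 1 \<noteq> 0" "p \<noteq> 0"
  proof -
    show "p \<noteq> 0"
      using p(2) by auto
    from nth_subdegree_nonzero[OF this] show "p $ 1 \<noteq> 0"
      unfolding p(2) .
    show "p $ 0 = 0"
      by (rule nth_less_subdegree_zero) (simp add: p(2))
  qed
  \<comment> \<open>On the upper level \<open>fps_X\<close> stands for \<open>y\<close>. Multiplying
    \<open>W^2 + W = u\<close> by \<open>z^(2d)\<close> gives \<open>y^2 + y z^d = p(z)\<close>,
    which in characteristic 2 is the equation solved here for \<open>z\<close>.\<close>
  obtain Z where Z: "Z $ 0 = 0" "(p oo Z) + fps_X * Z ^ d = fps_X ^ 2"
    by (rule perturbed_parameter_solution[OF p01(1,2), of fps_X "fps_X ^ 2" d]) (use d in simp_all)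
  have Z0: "Z \<noteq> 0"
  proof
    assume "Z = 0"
    then have "(p oo Z) + fps_X * Z ^ d = 0"
      using d p01(1) by simp
    then have "(fps_X :: 'k fps) ^ 2 = 0"
      unfolding Z(2) .
    then show False
      by simp
  qed
  \<comment> \<open>The extension is totally ramified: \<open>fps_X * Z ^ d\<close> has larger order
    than \<open>Z\<close>, so \<open>p(Z)\<close> alone accounts for the order of
    \<open>fps_X ^ 2\<close>.\<close>
  have Z2: "subdegree Z = 2"
  proof -
    have "subdegree Z > 0"
      using Z(1) Z0 by (metis gr0I nth_subdegree_nonzero)
    have "subdegree (p oo Z) = subdegree Z" "p oo Z \<noteq> 0"
      using Z(1) Z0 p(2) p01(3) by (simp_all add: fps_compose_eq_0_iff)
    moreover have "subdegree Z < subdegree (fps_X * Z ^ d)"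
      using Z0 d by (cases d) simp_all
    ultimately have "subdegree ((p oo Z) + fps_X * Z ^ d) = subdegree Z"
      by (subst subdegree_add_eq1) simp_all
    then show ?thesis
      by (simp add: Z(2))
  qed
  \<comment> \<open>\<open>\<iota>\<close> embeds \<open>k((z))\<close> into
    \<open>k((y))\<close>.\<close>
  define \<iota> where "\<iota> x = fls_compose_fps x Z" for x
  have \<iota>_hom: "\<iota> (x + y) = \<iota> x + \<iota> y" "\<iota> (x * y) = \<iota> x * \<iota> y" "\<iota> (x ^ n) = \<iota> x ^ n" "\<iota> 1 = 1"
    "\<iota> x = 0 \<longleftrightarrow> x = 0" for x y n
    using Z Z0 by (simp_all add: \<iota>_def fls_compose_fps_add fls_compose_fps_mult fls_compose_fps_power fls_compose_fps_eq_0_iff)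
  have \<iota>_AS: "\<iota> (artin_schreier x) = artin_schreier (\<iota> x)" for x
    by (simp add: artin_schreier_def \<iota>_hom)
  have \<iota>_fps: "\<iota> (fps_to_fls f) = fps_to_fls (f oo Z)" for f
    unfolding \<iota>_def by (rule fls_compose_fps_to_fls) (simp_all add: Z Z0)
  define W where "W = fls_X / fps_to_fls Z ^ d"
  have ZW: "fps_to_fls Z ^ d * W = fls_X"
    using Z0 by (simp add: W_def)
  have W: "\<iota> u = artin_schreier W"
  proof -
    have rel: "\<iota> (fps_to_fls p) + fls_X * fps_to_fls Z ^ d = fls_X ^ 2"
      using arg_cong[OF Z(2), of fps_to_fls] by (simp add: \<iota>_fps fls_times_fps_to_fls fps_to_fls_power)
    have "\<iota> u * fps_to_fls Z ^ (2 * d) = \<iota> (fps_to_fls p)"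
      using Z by (simp add: p \<iota>_hom) (simp add: \<iota>_def)
    also have "\<dots> = fls_X ^ 2 + fls_X * fps_to_fls Z ^ d"
      unfolding rel[symmetric] using add_self[of "fls_X * fps_to_fls Z ^ d"] by (simp add: add.assoc)
    also have "\<dots> = artin_schreier W * fps_to_fls Z ^ (2 * d)"
      unfolding artin_schreier_def ZW[symmetric] by (simp add: algebra_simps power2_eq_square power_mult)
    finally show ?thesis
      using Z0 by simp
  qed
  define S where "S g = s g oo Z" for g
  have S: "S g $ 0 = 0" "S g \<noteq> 0" if "g \<in> carrier G" for g
    using that Z(1) Z0 s_nth_0[OF that] s_nonzero[OF that] by (simp_all add: S_def fps_compose_eq_0_iff)
  have \<iota>_act_X: "\<iota> (act g fls_X) = fps_to_fls (S g)" if "g \<in> carrier G" for g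
    using that by (simp add: act_def \<iota>_fps S_def)
  \<comment> \<open>\<open>S g\<close> is \<open>g(z)\<close> expressed in \<open>y\<close>, and
    \<open>V g\<close> is the image that \<open>y = z^d W\<close> must have under
    \<open>g\<close>.\<close>
  define V where "V g = fps_to_fls (S g) ^ d * (W + \<iota> (c g))" for g
  \<comment> \<open>This is \<open>g(W)^2 + g(W) = g(u)\<close> multiplied by
    \<open>g(z)^(2d)\<close>; being monic over power series, it forces \<open>V g\<close> to be a
    power series.\<close>
  have V: "V g ^ 2 + fps_to_fls (S g ^ d) * V g = fps_to_fls (p oo S g)" if g: "g \<in> carrier G" for g
  proof -
    have "fps_to_fls (p oo S g) = \<iota> (act g (fps_to_fls p))"
      using g Z s_nth_0[OF g] s_nonzero[OF g] by (simp add: S_def act_def \<iota>_fps fps_compose_assoc)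
    also have "\<dots> = \<iota> (act g u) * fps_to_fls (S g) ^ (2 * d)"
      using g by (simp add: p act_mult act_power \<iota>_hom \<iota>_act_X)
    also have "\<iota> (act g u) = artin_schreier (W + \<iota> (c g))"
      using g by (simp add: u \<iota>_hom W \<iota>_AS AS_add)
    also have "artin_schreier (W + \<iota> (c g)) * fps_to_fls (S g) ^ (2 * d) = V g ^ 2 + fps_to_fls (S g ^ d) * V g"
      unfolding artin_schreier_def V_def by (simp add: algebra_simps power2_eq_square power_mult fps_to_fls_power)
    finally show ?thesis ..
  qed
  have "\<forall>g\<in>carrier G. \<exists>Y. fps_to_fls Y = V g \<and> Y $ 0 = 0"
    using fls_integral_quadratic[OF V] S d p01(1) by simp
  then obtain Y where Y: "\<And>g. g \<in> carrier G \<Longrightarrow> fps_to_fls (Y g) = V g" "\<And>g. g \<in> carrier G \<Longrightarrow> Y g $ 0 = 0"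
    by metis
  have Y_eq: "Y g ^ 2 + S g ^ d * Y g = p oo S g" if "g \<in> carrier G" for g
  proof -
    have "fps_to_fls (Y g ^ 2 + S g ^ d * Y g) = fps_to_fls (p oo S g)"
      using V[OF that] Y(1)[OF that] by (simp add: fls_times_fps_to_fls fps_to_fls_power)
    then show ?thesis
      unfolding fps_to_fls_eq_iff .
  qed
  have Y0: "Y g \<noteq> 0" if "g \<in> carrier G" for g
    using Y_eq[OF that] S[OF that] p01 by (auto simp: fps_compose_eq_0_iff)
  have CF: "CHAR('k fps) = 2"
    using char2 by simp
  note fps_add_self = char2_add_self[OF CF]
  \<comment> \<open>Substituting \<open>Y g\<close> for \<open>y\<close> in the equation of
    \<open>Z\<close> shows that \<open>Z oo Y g\<close> and \<open>S g\<close> solve the same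
    perturbed equation, whose solution is unique.\<close>
  have ZY: "Z oo Y g = S g" if g: "g \<in> carrier G" for g
  proof -
    have "(p oo (Z oo Y g)) + Y g * (Z oo Y g) ^ d = ((p oo Z) + fps_X * Z ^ d) oo Y g"
      using Y(2)[OF g] Z(1) by (simp add: fps_compose_add_distrib fps_compose_mult_distrib fps_compose_assoc fps_compose_power)
    also have "\<dots> = Y g ^ 2"
      unfolding Z(2) using Y(2)[OF g] by (simp add: fps_compose_power[symmetric])
    also have "\<dots> = (p oo S g) + Y g * S g ^ d"
      unfolding Y_eq[OF g, symmetric] using fps_add_self[of "Y g * S g ^ d"] by (simp add: mult.commute add.assoc)
    finally show ?thesis
      using perturbed_parameter_subdegree(2)[OF p01(1,2) Y(2)[OF g], of "Z oo Y g" "S g" d] Z(1) S(1)[OF g] by simp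
  qed
  \<comment> \<open>\<open>\<psi> g\<close> extends \<open>act g\<close> to \<open>k((y))\<close>.
    Its effect on the image of \<open>\<iota>\<close> and on \<open>W\<close> yields the action law
    when it is applied to \<open>V h\<close>.\<close>
  define \<psi> where "\<psi> g x = fls_compose_fps x (Y g)" for g x
  have \<psi>_hom: "\<psi> g (x + y) = \<psi> g x + \<psi> g y" "\<psi> g (x * y) = \<psi> g x * \<psi> g y" "\<psi> g (x ^ n) = \<psi> g x ^ n"
    if "g \<in> carrier G" for g x y n
    using Y(2)[OF that] Y0[OF that] by (simp_all add: \<psi>_def fls_compose_fps_add fls_compose_fps_mult fls_compose_fps_power)
  have \<psi>_\<iota>: "\<psi> g (\<iota> x) = \<iota> (act g x)" if "g \<in> carrier G" for g x
    using that Z(1) Z0 Y(2)[OF that] Y0[OF that] s_nth_0[OF that] s_nonzero[OF that] ZY[OF that]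
    by (simp add: \<psi>_def \<iota>_def act_def fls_compose_fps_assoc S_def)
  have \<psi>_W: "\<psi> g W = W + \<iota> (c g)" if g: "g \<in> carrier G" for g
  proof -
    have "fps_to_fls (S g) ^ d * \<psi> g W = \<psi> g (fps_to_fls Z ^ d * W)"
      using g Y(2)[OF g] Y0[OF g] by (simp add: \<psi>_hom) (simp add: \<psi>_def ZY)
    also have "\<dots> = fps_to_fls (S g) ^ d * (W + \<iota> (c g))"
      using Y(1)[OF g] by (simp add: ZW \<psi>_def V_def)
    finally show ?thesis
      using S(2)[OF g] by simp
  qed
  have Y_mult: "Y (g \<otimes> h) = Y h oo Y g" if gh: "g \<in> carrier G" "h \<in> carrier G" for g h
  proof -
    have "fps_to_fls (Y h oo Y g) = \<psi> g (V h)"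
      using Y Y0 gh by (simp add: \<psi>_def flip: Y(1))
    also have "\<dots> = \<iota> (act g (act h fls_X)) ^ d * (W + \<iota> (c g) + \<iota> (act g (c h)))"
      using gh by (simp add: V_def \<psi>_hom \<psi>_W \<psi>_\<iota> flip: \<iota>_act_X)
    also have "\<dots> = V (g \<otimes> h)"
      using gh by (simp add: V_def cocycle_mult[OF c] \<iota>_hom add.assoc flip: \<iota>_act_X act_act)
    also have "\<dots> = fps_to_fls (Y (g \<otimes> h))"
      using gh by (simp add: Y(1))
    finally show ?thesis
      by simp
  qed
  have Y_ker: "fps_to_fls (Y g) = fls_X + fps_to_fls Z ^ d * \<iota> (c g)" if "g \<in> act_ker" for g
  proof -
    have "S g = Z"
      using that Z(1) by (simp add: S_def act_ker_def)
    then show ?thesis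
      using Y(1)[of g] act_ker_closed[OF that] ZW by (simp add: V_def distrib_left)
  qed
  have Y_ker_iff: "Y g = fps_X \<longleftrightarrow> c g = 0" if "g \<in> act_ker" for g
  proof -
    have "Y g = fps_X \<longleftrightarrow> fps_to_fls (Y g) = fls_X"
      by (metis fps_X_to_fls fps_to_fls_eq_iff)
    then show ?thesis
      using Y_ker[OF that] Z0 by (simp add: \<iota>_hom)
  qed
  have ker: "g \<in> act_ker" if "g \<in> carrier G" "Y g = fps_X" for g
  proof -
    \<comment> \<open>An element fixing \<open>y\<close> also fixes the series \<open>Z\<close> in
      \<open>y\<close>, that is, \<open>z\<close>.\<close>
    have "(s g - fps_X) oo Z = 0"
      using ZY[OF that(1)] that(2) Z(1) by (simp add: fps_compose_sub_distrib S_def)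
    then show ?thesis
      using Z0 Z(1) that(1) by (simp add: fps_compose_eq_0_iff act_ker_def)
  qed
  have one: "\<one> \<in> act_ker" "c \<one> = 0"
    using cocycle_mult[OF c, of \<one> \<one>] s_one act_ker_act[of \<one>] add_self[of "c \<one>"] by (auto simp: act_ker_def)
  show ?thesis
  proof (rule that)
    show "series_action G Y"
      by unfold_locales (use Y Y_mult Y_ker_iff one in auto)
    show "{g \<in> carrier G. Y g = fps_X} = {g \<in> act_ker. c g = 0}"
      using ker Y_ker_iff act_ker_closed by blast
    show "subdegree (Y g - fps_X) + subdegree (Y (g \<otimes> \<nu>) - fps_X) = 2 * subdegree (s g - fps_X)"
      if g: "g \<in> carrier G - act_ker" and \<nu>: "\<nu> \<in> act_ker" "c \<nu> = 1" for g \<nu>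
    proof -
      have cl: "g \<in> carrier G" "\<nu> \<in> carrier G" "g \<otimes> \<nu> \<in> carrier G"
        using g \<nu> act_ker_closed by auto
      have sg: "s (g \<otimes> \<nu>) = s g"
        using s_ker_right \<nu>(1) cl(1) .
      have "g \<otimes> \<nu> \<notin> act_ker"
        using g cl sg by (simp add: act_ker_def)
      then have ne: "Y g - fps_X \<noteq> 0" "Y (g \<otimes> \<nu>) - fps_X \<noteq> 0"
        using ker g cl by auto
      have "fps_to_fls (Y (g \<otimes> \<nu>)) = fps_to_fls (Y g + S g ^ d)"
        using cl \<nu> by (simp add: Y(1) V_def S_def sg cocycle_mult[OF c] \<iota>_hom algebra_simps fps_to_fls_power)
      then have Y\<nu>: "Y (g \<otimes> \<nu>) = Y g + S g ^ d"
        unfolding fps_to_fls_eq_iff .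
      \<comment> \<open>With \<open>S = S g\<close>, the series \<open>Y g\<close> and
        \<open>Y (g \<otimes> \<nu>)\<close> are the roots of \<open>T^2 + S^d T + p(S)\<close>, so
        the product is its value at \<open>T = y\<close>. The equation for \<open>y\<close> turns
        this into a difference of perturbed parameters at \<open>S\<close> and
        \<open>Z\<close>.\<close>
      have "(Y g - fps_X) * (Y (g \<otimes> \<nu>) - fps_X)
          = (Y g ^ 2 + S g ^ d * Y g) - (fps_X ^ 2 - fps_X * S g ^ d) - (fps_X * (Y g + S g ^ d) + fps_X * (Y g + S g ^ d)) +
            (fps_X ^ 2 + fps_X ^ 2)"
        unfolding Y\<nu> by (simp add: algebra_simps power2_eq_square)
      also have "\<dots> = (p oo S g) + fps_X * S g ^ d - ((p oo Z) + fps_X * Z ^ d)"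
        unfolding fps_add_self Y_eq[OF cl(1)] Z(2) by (simp add: algebra_simps)
      finally have "subdegree ((Y g - fps_X) * (Y (g \<otimes> \<nu>) - fps_X)) = subdegree (S g - Z)"
        using perturbed_parameter_subdegree(1)[OF p01(1,2), of fps_X "S g" Z d] S(1)[OF cl(1)] Z(1) by simp
      also have "S g - Z = (s g - fps_X) oo Z"
        using Z(1) by (simp add: S_def fps_compose_sub_distrib)
      also have "subdegree \<dots> = 2 * subdegree (s g - fps_X)"
        using Z(1) Z2 by simp
      finally show ?thesis
        using ne by simp
    qed
  qed
qed

text \<open>With \<open>c\<close> the indicator of the complement of \<open>H\<close> on
  \<open>act_ker\<close>, the lift has kernel \<open>H\<close>. Translation by
  \<open>\<mu> \<otimes> \<mu>\<close> permutes \<open>A\<close>, so summing the identity for the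
  two lifts over \<open>A\<close> counts each upper order twice, and the totals agree.\<close>

lemma kernel_refinement:
  assumes H: "H \<lhd> G" "H \<subseteq> act_ker"
    and index2: "\<And>x y. x \<in> act_ker - H \<Longrightarrow> y \<in> act_ker - H \<Longrightarrow> x \<otimes> y \<in> H"
    and \<mu>: "\<mu> \<in> carrier G" "\<mu> \<otimes> \<mu> \<in> act_ker - H"
  obtains Y :: "'a \<Rightarrow> 'k fps" where "series_action G Y"
    and "{g \<in> carrier G. Y g = fps_X} = H"
    and "\<And>A. A \<subseteq> carrier G - act_ker \<Longrightarrow> (\<And>g. g \<in> A \<Longrightarrow> g \<otimes> (\<mu> \<otimes> \<mu>) \<in> A) \<Longrightarrow>
      (\<Sum>g\<in>A. subdegree (Y g - fps_X)) = (\<Sum>g\<in>A. subdegree (s g - fps_X))"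
proof -
  obtain c u d where c: "cocycle c" "\<And>n. n \<in> act_ker \<Longrightarrow> c n = of_bool (n \<notin> H)"
    and u: "\<And>g. g \<in> carrier G \<Longrightarrow> act g u = u + artin_schreier (c g)"
      "d > 0" "fls_subdegree u = 1 - 2 * int d"
    using reduced_cocycle_exists[OF H index2 \<mu>] by blast
  obtain Y :: "'a \<Rightarrow> 'k fps" where Y: "series_action G Y"
    and ker: "{g \<in> carrier G. Y g = fps_X} = {g \<in> act_ker. c g = 0}"
    and deg: "\<And>g \<nu>. g \<in> carrier G - act_ker \<Longrightarrow> \<nu> \<in> act_ker \<Longrightarrow> c \<nu> = 1 \<Longrightarrow>
      subdegree (Y g - fps_X) + subdegree (Y (g \<otimes> \<nu>) - fps_X) = 2 * subdegree (s g - fps_X)"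
    using quadratic_lift[OF c(1) u] by blast
  show ?thesis
  proof (rule that[OF Y])
    show "{g \<in> carrier G. Y g = fps_X} = H"
      unfolding ker using c(2) H(2) by auto
    fix A assume A: "A \<subseteq> carrier G - act_ker" "\<And>g. g \<in> A \<Longrightarrow> g \<otimes> (\<mu> \<otimes> \<mu>) \<in> A"
    define \<nu> where "\<nu> = \<mu> \<otimes> \<mu>"
    have \<nu>: "\<nu> \<in> carrier G" "\<nu> \<in> act_ker" "c \<nu> = 1"
      using \<mu> c(2) by (auto simp: \<nu>_def)
    have "inj_on (\<lambda>g. g \<otimes> \<nu>) A"
      using A(1) \<nu>(1) by (intro inj_onI) (auto simp: subset_iff)
    moreover have "finite A"
      using A(1) fin finite_subset by blast
    ultimately have "bij_betw (\<lambda>g. g \<otimes> \<nu>) A A"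
      using A(2) unfolding \<nu>_def[symmetric] bij_betw_def by (intro conjI endo_inj_surj) auto
    then have "(\<Sum>g\<in>A. subdegree (Y (g \<otimes> \<nu>) - fps_X)) = (\<Sum>g\<in>A. subdegree (Y g - fps_X))"
      by (rule sum.reindex_bij_betw)
    then have "2 * (\<Sum>g\<in>A. subdegree (Y g - fps_X))
        = (\<Sum>g\<in>A. subdegree (Y g - fps_X) + subdegree (Y (g \<otimes> \<nu>) - fps_X))"
      by (simp add: sum.distrib)
    also have "\<dots> = 2 * (\<Sum>g\<in>A. subdegree (s g - fps_X))"
      unfolding sum_distrib_left using A(1) \<nu> by (intro sum.cong refl deg) auto
    finally show "(\<Sum>g\<in>A. subdegree (Y g - fps_X)) = (\<Sum>g\<in>A. subdegree (s g - fps_X))"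
      by simp
  qed
qed

end

section \<open>The quaternion group\<close>

locale quaternion =
  fixes n :: nat
  assumes n: "n \<ge> 2"
begin

definition G where "G = quat_group n"
definition \<sigma> where "\<sigma> = quat_sigma n"
definition \<tau> where "\<tau> = quat_tau n"

sublocale group G
  unfolding G_def by (rule quat_group_group)

lemma closed [simp]: "\<sigma> \<in> carrier G" "\<tau> \<in> carrier G"
  by (simp_all add: G_def \<sigma>_def \<tau>_def quat_sigma_closed quat_tau_closed)

lemma tau_pow_order: "\<tau> [^]\<^bsub>G\<^esub> (2 ^ n :: nat) = \<one>\<^bsub>G\<^esub>"
  and conj_tau: "\<sigma> \<otimes>\<^bsub>G\<^esub> \<tau> \<otimes>\<^bsub>G\<^esub> inv\<^bsub>G\<^esub> \<sigma> = inv\<^bsub>G\<^esub> \<tau>"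
  using quat_relations[of n] by (simp_all add: G_def \<sigma>_def \<tau>_def)

lemma finite_carrier: "finite (carrier G)"
  using quat_group_order[OF n] by (simp add: G_def)

definition nf :: "nat \<times> bool \<Rightarrow> quat_gen letter list set" where
  "nf x = \<tau> [^]\<^bsub>G\<^esub> fst x \<otimes>\<^bsub>G\<^esub> (if snd x then \<sigma> else \<one>\<^bsub>G\<^esub>)"

lemma nf_closed: "nf x \<in> carrier G"
  by (simp add: nf_def)

lemma carrier_nf:
  assumes "g \<in> carrier G"
  obtains i b where "i < 2 ^ n" "g = nf (i, b)"
proof -
  have "g \<in> carrier (quat_group n)"
    using assms by (simp add: G_def)
  then show ?thesis
  proof (rule quat_normal_form)
    fix i :: nat and b
    assume "i < 2 ^ n" "g = quat_tau n [^]\<^bsub>quat_group n\<^esub> i \<otimes>\<^bsub>quat_group n\<^esub>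
      (if b then quat_sigma n else \<one>\<^bsub>quat_group n\<^esub>)"
    then show ?thesis
      using that[of i b] by (simp add: nf_def G_def \<sigma>_def \<tau>_def)
  qed
qed

text \<open>The normal forms exhaust the group, and their number equals its order.\<close>

lemma nf_inj: "inj_on nf ({..<2 ^ n} \<times> UNIV)"
proof (rule eq_card_imp_inj_on)
  have "nf ` ({..<2 ^ n} \<times> UNIV) = carrier G"
    using nf_closed by (auto elim!: carrier_nf)
  then show "card (nf ` ({..<2 ^ n} \<times> UNIV)) = card ({..<2 ^ n :: nat} \<times> (UNIV :: bool set))"
    using quat_group_order(2)[OF n] by (simp add: G_def card_cartesian_product)
qed simp

lemma tau_pow_mod: "\<tau> [^]\<^bsub>G\<^esub> (i mod 2 ^ n :: nat) = \<tau> [^]\<^bsub>G\<^esub> i"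
proof -
  have "\<tau> [^]\<^bsub>G\<^esub> i = \<tau> [^]\<^bsub>G\<^esub> (2 ^ n * (i div 2 ^ n) + i mod 2 ^ n)"
    by simp
  also have "\<dots> = (\<tau> [^]\<^bsub>G\<^esub> (2 ^ n :: nat)) [^]\<^bsub>G\<^esub> (i div 2 ^ n) \<otimes>\<^bsub>G\<^esub> \<tau> [^]\<^bsub>G\<^esub> (i mod 2 ^ n)"
    by (simp only: nat_pow_mult nat_pow_pow closed)
  finally show ?thesis
    by (simp add: tau_pow_order)
qed

lemma nf_eq: "nf (i, b) = nf (j, c) \<longleftrightarrow> i mod 2 ^ n = j mod 2 ^ n \<and> b = c"
proof -
  have "nf (i, b) = nf (i mod 2 ^ n, b)" for i b
    by (simp add: nf_def tau_pow_mod)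
  then have "nf (i, b) = nf (j, c) \<longleftrightarrow> nf (i mod 2 ^ n, b) = nf (j mod 2 ^ n, c)"
    by metis
  also have "\<dots> \<longleftrightarrow> i mod 2 ^ n = j mod 2 ^ n \<and> b = c"
    using inj_on_eq_iff[OF nf_inj, of "(i mod 2 ^ n, b)" "(j mod 2 ^ n, c)"] by simp
  finally show ?thesis .
qed

text \<open>The subgroup generated by the power of \<open>\<tau>\<close> with exponent
  \<open>2^j\<close>. The chain leads from \<open>H 1\<close>, with Klein four quotient, down to the
  trivial \<open>H n\<close>.\<close>

definition H :: "nat \<Rightarrow> quat_gen letter list set set" where
  "H j = range (\<lambda>i. \<tau> [^]\<^bsub>G\<^esub> (2 ^ j * i :: nat))"

lemma tau_pow_nf: "\<tau> [^]\<^bsub>G\<^esub> i = nf (i, False)"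
  by (simp add: nf_def)

text \<open>Exponents count modulo \<open>2^n\<close>, and \<open>j \<le> n\<close> makes
  divisibility by \<open>2^j\<close> insensitive to this reduction.\<close>

lemma nf_in_H:
  assumes "j \<le> n"
  shows "nf (i, b) \<in> H j \<longleftrightarrow> 2 ^ j dvd i \<and> \<not> b"
proof
  assume "nf (i, b) \<in> H j"
  then obtain k where k: "i mod 2 ^ n = (2 ^ j * k) mod 2 ^ n" "\<not> b"
    unfolding H_def by (auto simp: tau_pow_nf nf_eq)
  have "(2 :: nat) ^ j dvd 2 ^ n"
    using assms by (rule le_imp_power_dvd)
  then have "2 ^ j dvd i mod 2 ^ n \<longleftrightarrow> 2 ^ j dvd i"
    by (rule dvd_mod_iff)
  moreover have "2 ^ j dvd (2 ^ j * k) mod 2 ^ n"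
    using \<open>2 ^ j dvd 2 ^ n\<close> by (simp add: dvd_mod)
  ultimately show "2 ^ j dvd i \<and> \<not> b"
    using k by simp
qed (auto simp: H_def tau_pow_nf elim!: dvdE)

lemma H_antimono: "i \<le> j \<Longrightarrow> H j \<subseteq> H i"
  unfolding H_def by (auto simp: le_iff_add power_add mult.assoc)

text \<open>Powers of \<open>\<tau>\<close> commute with each other and \<open>\<sigma>\<close>
  inverts them; the normal form of \<open>x\<close> reduces conjugation to these two cases.\<close>

lemma H_normal: "H j \<lhd> G"
proof (rule normal_invI)
  have inv: "inv\<^bsub>G\<^esub> (\<tau> [^]\<^bsub>G\<^esub> i) = \<tau> [^]\<^bsub>G\<^esub> ((2 ^ n - 1) * i)" for i :: nat
  proof (rule inv_equality)
    have "\<tau> [^]\<^bsub>G\<^esub> ((2 ^ n - 1) * i) \<otimes>\<^bsub>G\<^esub> \<tau> [^]\<^bsub>G\<^esub> i = \<tau> [^]\<^bsub>G\<^esub> (2 ^ n * i)"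
      by (simp add: nat_pow_mult algebra_simps)
    also have "\<dots> = \<one>\<^bsub>G\<^esub>"
      by (simp add: tau_pow_order flip: nat_pow_pow)
    finally show "\<tau> [^]\<^bsub>G\<^esub> ((2 ^ n - 1) * i) \<otimes>\<^bsub>G\<^esub> \<tau> [^]\<^bsub>G\<^esub> i = \<one>\<^bsub>G\<^esub>" .
  qed simp_all
  have H_inv: "inv\<^bsub>G\<^esub> h \<in> H j" if "h \<in> H j" for h
    using that by (auto simp: H_def inv mult.left_commute)
  show sub: "subgroup (H j) G"
  proof (rule subgroupI)
    show "H j \<subseteq> carrier G" "H j \<noteq> {}"
      by (auto simp: H_def)
    show "inv\<^bsub>G\<^esub> h \<in> H j" if "h \<in> H j" for h
      using that by (rule H_inv)
    show "h \<otimes>\<^bsub>G\<^esub> k \<in> H j" if "h \<in> H j" "k \<in> H j" for h k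
      using that by (auto simp: H_def nat_pow_mult simp flip: distrib_left)
  qed
  have cancel: "inv\<^bsub>G\<^esub> \<sigma> \<otimes>\<^bsub>G\<^esub> (\<sigma> \<otimes>\<^bsub>G\<^esub> x) = x" if "x \<in> carrier G" for x
    using that by (simp flip: m_assoc)
  have conj_pow: "\<sigma> \<otimes>\<^bsub>G\<^esub> \<tau> [^]\<^bsub>G\<^esub> (i :: nat) \<otimes>\<^bsub>G\<^esub> inv\<^bsub>G\<^esub> \<sigma> = inv\<^bsub>G\<^esub> (\<tau> [^]\<^bsub>G\<^esub> i)" for i
  proof (induction i)
    case (Suc i)
    have "\<sigma> \<otimes>\<^bsub>G\<^esub> \<tau> [^]\<^bsub>G\<^esub> Suc i \<otimes>\<^bsub>G\<^esub> inv\<^bsub>G\<^esub> \<sigma>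
        = (\<sigma> \<otimes>\<^bsub>G\<^esub> \<tau> \<otimes>\<^bsub>G\<^esub> inv\<^bsub>G\<^esub> \<sigma>) \<otimes>\<^bsub>G\<^esub> (\<sigma> \<otimes>\<^bsub>G\<^esub> \<tau> [^]\<^bsub>G\<^esub> i \<otimes>\<^bsub>G\<^esub> inv\<^bsub>G\<^esub> \<sigma>)"
      unfolding nat_pow_Suc2[OF closed(2)] by (simp add: m_assoc cancel)
    then show ?case
      using Suc by (simp add: conj_tau inv_mult_group)
  qed simp
  fix x h assume x: "x \<in> carrier G" and h: "h \<in> H j"
  obtain i b where xi: "x = nf (i, b)"
    using carrier_nf[OF x] by blast
  obtain k :: nat where k: "h = \<tau> [^]\<^bsub>G\<^esub> (2 ^ j * k)"
    using h by (auto simp: H_def)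
  define s where "s = (if b then \<sigma> else \<one>\<^bsub>G\<^esub>)"
  define h' where "h' = s \<otimes>\<^bsub>G\<^esub> h \<otimes>\<^bsub>G\<^esub> inv\<^bsub>G\<^esub> s"
  have "h' \<in> H j"
    using h H_inv[OF h] conj_pow subgroup.subset[OF sub] by (auto simp: h'_def s_def k)
  then obtain k' :: nat where k': "h' = \<tau> [^]\<^bsub>G\<^esub> (2 ^ j * k')"
    by (auto simp: H_def)
  have [simp]: "s \<in> carrier G" "h \<in> carrier G"
    using h subgroup.subset[OF sub] by (auto simp: s_def)
  have "x \<otimes>\<^bsub>G\<^esub> h \<otimes>\<^bsub>G\<^esub> inv\<^bsub>G\<^esub> x = \<tau> [^]\<^bsub>G\<^esub> i \<otimes>\<^bsub>G\<^esub> h' \<otimes>\<^bsub>G\<^esub> inv\<^bsub>G\<^esub> (\<tau> [^]\<^bsub>G\<^esub> i)"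
    by (simp add: xi nf_def h'_def inv_mult_group m_assoc flip: s_def)
  also have "\<tau> [^]\<^bsub>G\<^esub> i \<otimes>\<^bsub>G\<^esub> h' = h' \<otimes>\<^bsub>G\<^esub> \<tau> [^]\<^bsub>G\<^esub> i"
    by (simp add: k' nat_pow_mult add.commute)
  also have "h' \<otimes>\<^bsub>G\<^esub> \<tau> [^]\<^bsub>G\<^esub> i \<otimes>\<^bsub>G\<^esub> inv\<^bsub>G\<^esub> (\<tau> [^]\<^bsub>G\<^esub> i) = h'"
    by (simp add: k' m_assoc)
  finally show "x \<otimes>\<^bsub>G\<^esub> h \<otimes>\<^bsub>G\<^esub> inv\<^bsub>G\<^esub> x \<in> H j"
    using \<open>h' \<in> H j\<close> by simp
qed

lemma character_nf:
  assumes "order2_character G \<chi>"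
  shows "\<chi> (nf (i, b)) = \<chi> \<tau> ^ i * (if b then \<chi> \<sigma> else 1)"
proof -
  have mult: "\<chi> (g \<otimes>\<^bsub>G\<^esub> h) = \<chi> g * \<chi> h" if "g \<in> carrier G" "h \<in> carrier G" for g h
    using assms that by (auto simp: order2_character_def)
  have "\<chi> \<one>\<^bsub>G\<^esub> * \<chi> \<one>\<^bsub>G\<^esub> = \<chi> \<one>\<^bsub>G\<^esub>" "\<chi> \<one>\<^bsub>G\<^esub> \<in> {1, -1}"
    using mult[of "\<one>\<^bsub>G\<^esub>" "\<one>\<^bsub>G\<^esub>"] assms by (auto simp: order2_character_def)
  then have one: "\<chi> \<one>\<^bsub>G\<^esub> = 1"
    by auto
  have "\<chi> (\<tau> [^]\<^bsub>G\<^esub> i) = \<chi> \<tau> ^ i"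
    by (induction i) (simp_all add: one mult)
  then show ?thesis
    by (simp add: nf_def mult one)
qed

lemma character_values: "order2_character G \<chi> \<Longrightarrow> g \<in> carrier G \<Longrightarrow> \<chi> g \<in> {1, -1}"
  by (auto simp: order2_character_def)

text \<open>Elements of \<open>H 1\<close> are even powers of \<open>\<tau>\<close>. Hence the set
  where a character is -1 avoids \<open>H 1\<close> and is stable under it.\<close>

lemma character_trivial_on_H:
  assumes "order2_character G \<chi>" "h \<in> H 1"
  shows "\<chi> h = 1"
proof -
  obtain i where h: "h = nf (2 * i, False)"
    using assms(2) by (auto simp: H_def tau_pow_nf)
  have "\<chi> \<tau> \<in> {1, -1}"
    by (rule character_values[OF assms(1)]) simp
  then show ?thesis
    using assms(1) by (auto simp: h character_nf power_mult power2_eq_square)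
qed

end

section \<open>The Klein four group\<close>

text \<open>In the coordinate \<open>1/z\<close> this is the translation by
  \<open>l\<close>.\<close>

definition moebius :: "'k::field \<Rightarrow> 'k fps" where
  "moebius l = fps_X * inverse (1 + fps_const l * fps_X)"

lemma moebius_mult: "moebius l * (1 + fps_const l * fps_X) = fps_X"
  by (simp add: moebius_def mult.assoc inverse_mult_eq_1)

lemma moebius_nth_0 [simp]: "moebius l $ 0 = 0"
  by (simp add: moebius_def)

text \<open>Translations of \<open>1/z\<close> add; within power series this is seen by clearing the
  denominator \<open>1 + (a + b) z\<close>.\<close>

lemma moebius_compose: "moebius b oo moebius a = moebius (a + b)"
proof -
  have unit: "1 + fps_const l * fps_X \<noteq> (0 :: 'a fps)" for l
  proof
    assume "1 + fps_const l * fps_X = (0 :: 'a fps)"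
    then have "(1 + fps_const l * fps_X) $ 0 = (0 :: 'a fps) $ 0"
      by simp
    then show False
      by simp
  qed
  have "(moebius b oo moebius a) * (1 + fps_const b * moebius a) = moebius b * (1 + fps_const b * fps_X) oo moebius a"
    by (simp add: fps_compose_mult_distrib fps_compose_add_distrib)
  also have "\<dots> = moebius a"
    by (simp add: moebius_mult)
  finally have "(moebius b oo moebius a) * ((1 + fps_const b * moebius a) * (1 + fps_const a * fps_X)) = fps_X"
    by (simp add: moebius_mult flip: mult.assoc)
  also have "(1 + fps_const b * moebius a) * (1 + fps_const a * fps_X)
      = 1 + fps_const a * fps_X + fps_const b * (moebius a * (1 + fps_const a * fps_X))"
    by (simp add: algebra_simps)
  also have "\<dots> = 1 + fps_const (a + b) * fps_X"
    unfolding moebius_mult by (simp add: algebra_simps flip: fps_const_add)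
  finally have "(moebius b oo moebius a) * (1 + fps_const (a + b) * fps_X)
      = moebius (a + b) * (1 + fps_const (a + b) * fps_X)"
    by (simp add: moebius_mult)
  then show ?thesis
    using unit[of "a + b"] by simp
qed

text \<open>The difference is \<open>-l z^2 / (1 + l z)\<close>.\<close>

lemma moebius_diff_X:
  shows "moebius l = fps_X \<longleftrightarrow> l = 0"
    and "l \<noteq> 0 \<Longrightarrow> subdegree (moebius l - fps_X) = 2"
proof -
  define D where "D = moebius l - fps_X"
  have "D * (1 + fps_const l * fps_X) = fps_X - fps_X * (1 + fps_const l * fps_X)"
    by (simp only: D_def left_diff_distrib moebius_mult)
  also have "\<dots> = fps_const (- l) * fps_X ^ 2"
    by (simp add: algebra_simps power2_eq_square flip: fps_const_neg)
  finally have D: "D * (1 + fps_const l * fps_X) = fps_const (- l) * fps_X ^ 2" .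
  define U where "U = 1 + fps_const l * fps_X"
  have U: "subdegree U = 0" "U \<noteq> 0"
    using moebius_mult[of l] by (auto simp: U_def intro!: subdegreeI)
  have "D \<noteq> 0 \<and> subdegree D = 2" if "l \<noteq> 0"
  proof -
    have rhs: "fps_const (- l) * fps_X ^ 2 \<noteq> 0" "subdegree (fps_const (- l) * fps_X ^ 2) = 2"
      using that by simp_all
    then have "D \<noteq> 0"
      using D by auto
    then show ?thesis
      using arg_cong[OF D[folded U_def], of subdegree] U rhs(2) by simp
  qed
  moreover have "l = 0 \<Longrightarrow> D = 0"
    by (simp add: D_def moebius_def)
  ultimately show "moebius l = fps_X \<longleftrightarrow> l = 0" "l \<noteq> 0 \<Longrightarrow> subdegree (moebius l - fps_X) = 2"
    by (auto simp: D_def)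
qed

context quaternion
begin

lemma klein_four_action:
  assumes char2: "CHAR('k::alg_closed_field) = 2"
  obtains s :: "quat_gen letter list set \<Rightarrow> 'k::alg_closed_field fps" where "series_action G s"
    and "{g \<in> carrier G. s g = fps_X} = H 1"
    and "\<And>g. g \<in> carrier G - H 1 \<Longrightarrow> subdegree (s g - fps_X) = 2"
proof -
  have two: "(1 :: 'k) + 1 = 0"
    using char2 by (rule char2_add_self)
  \<comment> \<open>A root of \<open>1 + x + x^2\<close> lies outside {0, 1}, so 1 and
    \<open>\<beta>\<close> are linearly independent over the field with two elements.\<close>
  have "degree [:1, 1, 1 :: 'k:] > 0"
    by simp
  then obtain \<beta> :: 'k where "poly [:1, 1, 1:] \<beta> = 0"
    using alg_closed_imp_poly_has_root by blast
  then have \<beta>: "\<beta> \<noteq> 0" "\<beta> \<noteq> 1" "1 + \<beta> \<noteq> 0"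
    using two by (auto simp: algebra_simps add_eq_0_iff2)
  obtain \<chi>\<^sub>0 where \<chi>\<^sub>0: "order2_character G \<chi>\<^sub>0" "\<chi>\<^sub>0 \<sigma> = -1" "\<chi>\<^sub>0 \<tau> = 1"
    using quat_sign_character[OF n, of "-1" 1] unfolding G_def \<sigma>_def \<tau>_def by auto
  obtain \<chi>\<^sub>1 where \<chi>\<^sub>1: "order2_character G \<chi>\<^sub>1" "\<chi>\<^sub>1 \<sigma> = 1" "\<chi>\<^sub>1 \<tau> = -1"
    using quat_sign_character[OF n, of 1 "-1"] unfolding G_def \<sigma>_def \<tau>_def by auto
  define \<epsilon> where "\<epsilon> \<chi> g = (of_bool (\<chi> g \<noteq> 1) :: 'k)" for \<chi> :: "quat_gen letter list set \<Rightarrow> complex" and g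
  have \<epsilon>_mult: "\<epsilon> \<chi> (g \<otimes>\<^bsub>G\<^esub> h) = \<epsilon> \<chi> g + \<epsilon> \<chi> h"
    if "order2_character G \<chi>" "g \<in> carrier G" "h \<in> carrier G" for \<chi> g h
    using that character_values[OF that(1,2)] character_values[OF that(1,3)] two
    by (auto simp: \<epsilon>_def order2_character_def)
  \<comment> \<open>\<open>l\<close> identifies \<open>G / H 1\<close> with the additive group
    spanned by 1 and \<open>\<beta>\<close>.\<close>
  define l where "l g = \<epsilon> \<chi>\<^sub>1 g + \<beta> * \<epsilon> \<chi>\<^sub>0 g" for g
  have l_mult: "l (g \<otimes>\<^bsub>G\<^esub> h) = l g + l h" if "g \<in> carrier G" "h \<in> carrier G" for g h
    using that \<chi>\<^sub>0 \<chi>\<^sub>1 by (simp add: l_def \<epsilon>_mult algebra_simps)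
  have l_ker: "l g = 0 \<longleftrightarrow> g \<in> H 1" if cl: "g \<in> carrier G" for g
  proof -
    obtain i b where g: "g = nf (i, b)"
      using carrier_nf[OF cl] by blast
    have "\<chi>\<^sub>0 g = 1 \<longleftrightarrow> \<not> b" "\<chi>\<^sub>1 g = 1 \<longleftrightarrow> even i"
      using \<chi>\<^sub>0 \<chi>\<^sub>1 by (auto simp: g character_nf minus_one_power_iff)
    then show ?thesis
      using \<beta> n by (auto simp: g nf_in_H l_def \<epsilon>_def)
  qed
  show ?thesis
  proof (rule that[of "\<lambda>g. moebius (l g)"])
    have "l \<one>\<^bsub>G\<^esub> = 0"
      using l_mult[of "\<one>\<^bsub>G\<^esub>" "\<one>\<^bsub>G\<^esub>"] char2_add_self[OF char2, of "l \<one>\<^bsub>G\<^esub>"] by (metis one_closed r_one)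
    then show "series_action G (\<lambda>g. moebius (l g))"
      by unfold_locales (simp_all add: l_mult moebius_compose moebius_diff_X(1))
    show "{g \<in> carrier G. moebius (l g) = fps_X} = H 1"
      using l_ker subgroup.subset[OF normal_imp_subgroup[OF H_normal]] by (auto simp: moebius_diff_X(1))
    show "subdegree (moebius (l g) - fps_X) = 2" if "g \<in> carrier G - H 1" for g
      using that l_ker by (intro moebius_diff_X(2)) auto
  qed
qed

text \<open>Single orders change under lifting, so the induction carries only their sums over sets
  stable under \<open>H 1\<close>; the sets where a quadratic character is -1 are of this
  kind.\<close>

lemma action_with_kernel_H:
  assumes char2: "CHAR('k::alg_closed_field) = 2" and "1 \<le> j" "j \<le> n"
  shows "\<exists>s :: quat_gen letter list set \<Rightarrow> 'k::alg_closed_field fps. series_action G s \<and> {g \<in> carrier G. s g = fps_X} = H j \<and>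
    (\<forall>A. A \<subseteq> carrier G - H 1 \<longrightarrow> (\<forall>g\<in>A. \<forall>h\<in>H 1. g \<otimes>\<^bsub>G\<^esub> h \<in> A) \<longrightarrow>
      (\<Sum>g\<in>A. subdegree (s g - fps_X)) = 2 * card A)"
  using assms(2,3)
proof (induction j rule: dec_induct)
  case base
  obtain s :: "quat_gen letter list set \<Rightarrow> 'k fps" where s: "series_action G s"
    "{g \<in> carrier G. s g = fps_X} = H 1" "\<And>g. g \<in> carrier G - H 1 \<Longrightarrow> subdegree (s g - fps_X) = 2"
    using klein_four_action[OF char2] by blast
  have "(\<Sum>g\<in>A. subdegree (s g - fps_X)) = 2 * card A" if "A \<subseteq> carrier G - H 1" for A
    using s(3) that by (simp add: subset_iff)
  then show ?case
    using s(1,2) by blast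
next
  case (step j)
  then obtain s :: "quat_gen letter list set \<Rightarrow> 'k fps" where s: "series_action G s"
    "{g \<in> carrier G. s g = fps_X} = H j"
    and deg: "\<And>A. A \<subseteq> carrier G - H 1 \<Longrightarrow> \<forall>g\<in>A. \<forall>h\<in>H 1. g \<otimes>\<^bsub>G\<^esub> h \<in> A \<Longrightarrow>
      (\<Sum>g\<in>A. subdegree (s g - fps_X)) = 2 * card A"
    by auto
  interpret S: series_action G s by fact
  interpret S: series_action_char2 G s
    by unfold_locales (use char2 finite_carrier in auto)
  have ker: "S.act_ker = H j"
    using s(2) by (simp add: S.act_ker_def)
  have Hj: "H j \<subseteq> H 1"
    using step(1) by (rule H_antimono)
  \<comment> \<open>The square of \<open>\<mu>\<close> generates \<open>H j\<close>. That it is a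
    square in \<open>G\<close> is what excludes the degenerate lift with
    \<open>u = 0\<close>.\<close>
  define \<mu> where "\<mu> = \<tau> [^]\<^bsub>G\<^esub> (2 ^ (j - 1) :: nat)"
  have "(2 :: nat) ^ (j - 1) + 2 ^ (j - 1) = 2 ^ j"
    using step(1) by (cases j) simp_all
  then have \<mu>\<mu>: "\<mu> \<otimes>\<^bsub>G\<^esub> \<mu> = nf (2 ^ j, False)"
    by (simp add: \<mu>_def nat_pow_mult flip: tau_pow_nf)
  have \<mu>: "\<mu> \<in> carrier G" "\<mu> \<otimes>\<^bsub>G\<^esub> \<mu> \<in> H j - H (Suc j)"
    using step.prems by (auto simp: \<mu>\<mu> nf_in_H) (simp add: \<mu>_def)
  have index2: "x \<otimes>\<^bsub>G\<^esub> y \<in> H (Suc j)" if xy: "x \<in> H j - H (Suc j)" "y \<in> H j - H (Suc j)" for x y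
  proof -
    have odd: "\<exists>i::nat. x = \<tau> [^]\<^bsub>G\<^esub> (2 ^ j * i) \<and> odd i" if x: "x \<in> H j - H (Suc j)" for x
    proof -
      obtain i :: nat where i: "x = \<tau> [^]\<^bsub>G\<^esub> (2 ^ j * i)"
        using x by (auto simp: H_def)
      have "even i \<Longrightarrow> x \<in> H (Suc j)"
        unfolding i H_def by (auto elim!: evenE simp: mult.assoc mult.left_commute)
      then show ?thesis
        using i x by blast
    qed
    obtain a b :: nat where ab: "x = \<tau> [^]\<^bsub>G\<^esub> (2 ^ j * a)" "y = \<tau> [^]\<^bsub>G\<^esub> (2 ^ j * b)" "odd a" "odd b"
      using odd[OF xy(1)] odd[OF xy(2)] by blast
    then obtain k where "a + b = 2 * k"
      by (meson evenE odd_even_add)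
    then have "x \<otimes>\<^bsub>G\<^esub> y = \<tau> [^]\<^bsub>G\<^esub> (2 ^ Suc j * k)"
      by (simp add: ab nat_pow_mult mult.assoc mult.left_commute flip: distrib_left)
    then show ?thesis
      by (auto simp: H_def)
  qed
  obtain Y :: "quat_gen letter list set \<Rightarrow> 'k fps" where Y: "series_action G Y"
    "{g \<in> carrier G. Y g = fps_X} = H (Suc j)"
    "\<And>A. A \<subseteq> carrier G - H j \<Longrightarrow> (\<And>g. g \<in> A \<Longrightarrow> g \<otimes>\<^bsub>G\<^esub> (\<mu> \<otimes>\<^bsub>G\<^esub> \<mu>) \<in> A) \<Longrightarrow>
      (\<Sum>g\<in>A. subdegree (Y g - fps_X)) = (\<Sum>g\<in>A. subdegree (s g - fps_X))"
    using S.kernel_refinement[OF H_normal, of "Suc j" \<mu>] index2 \<mu> H_antimono[of j "Suc j"] unfolding ker by auto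
  have "(\<Sum>g\<in>A. subdegree (Y g - fps_X)) = 2 * card A"
    if A: "A \<subseteq> carrier G - H 1" "\<forall>g\<in>A. \<forall>h\<in>H 1. g \<otimes>\<^bsub>G\<^esub> h \<in> A" for A
  proof -
    have "(\<Sum>g\<in>A. subdegree (Y g - fps_X)) = (\<Sum>g\<in>A. subdegree (s g - fps_X))"
      using A Hj \<mu>(2) by (intro Y(3)) auto
    then show ?thesis
      using deg[OF A] by simp
  qed
  then show ?case
    using Y(1,2) by blast
qed

end

section \<open>Artin conductors\<close>

context series_action
begin

lemma local_action:
  assumes "act_ker = {\<one>}"
  shows "local_action G (\<lambda>g f. f oo s g)"
proof -
  have comp: "(f oo s h) oo s g = f oo s (g \<otimes> h)" if "g \<in> carrier G" "h \<in> carrier G" for f g h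
    using that by (simp add: s_mult fps_compose_assoc s_nth_0)
  have "(\<lambda>f. f oo s g) \<in> carrier fps_aut" if g: "g \<in> carrier G" for g
  proof -
    have "bij (\<lambda>f. f oo s g)"
      by (rule o_bij[where g = "\<lambda>f. f oo s (inv g)"]) (use g in \<open>auto simp: fun_eq_iff comp s_one\<close>)
    then show ?thesis
      using g by (simp add: fps_aut_def fps_compose_add_distrib fps_compose_mult_distrib s_nth_0)
  qed
  then have "(\<lambda>g f. f oo s g) \<in> hom G fps_aut"
    by (auto simp: hom_def comp fun_eq_iff) (simp add: fps_aut_def comp fun_eq_iff)
  moreover have "inj_on (\<lambda>g f. f oo s g) (carrier G)"
  proof (rule inj_onI)
    fix g h assume gh: "g \<in> carrier G" "h \<in> carrier G" "(\<lambda>f. f oo s g) = (\<lambda>f. f oo s h)"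
    then have "fps_X oo s g = fps_X oo s h"
      by metis
    then have "s g = s h"
      using gh by (simp add: s_nth_0)
    then have "inv g \<otimes> h = \<one>"
      using inv_mult_act_ker[of g h] gh assms by simp
    then show "g = h"
      using gh by (metis inv_closed inv_equality inv_inv)
  qed
  ultimately show ?thesis
    by (simp add: local_action_def)
qed

text \<open>The value at \<open>\<one>\<close> adds up the orders of all other elements, so each
  order gets the weight \<open>1 - \<chi> g\<close>. Only \<open>A\<close> survives, with weight 2,
  and \<open>A\<close> is half of the group: the conductor is the average order over
  \<open>A\<close>.\<close>

lemma artin_mult_order2_character:
  assumes fin: "finite (carrier G)" and \<chi>: "order2_character G \<chi>"
  defines "A \<equiv> {g \<in> carrier G. \<chi> g = -1}"
  assumes deg: "(\<Sum>g\<in>A. subdegree (s g - fps_X)) = m * card A"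
  shows "artin_mult G (\<lambda>g f. f oo s g) \<chi> = of_nat m"
proof -
  have val: "\<chi> g \<in> {1, -1}" if "g \<in> carrier G" for g
    using \<chi> that by (auto simp: order2_character_def)
  have mult: "\<chi> (g \<otimes> h) = \<chi> g * \<chi> h" if "g \<in> carrier G" "h \<in> carrier G" for g h
    using \<chi> that by (auto simp: order2_character_def)
  have one: "\<chi> \<one> = 1"
    using mult[of \<one> \<one>] val[of \<one>] by auto
  obtain a where a: "a \<in> carrier G" "\<chi> a = -1"
    using \<chi> val by (auto simp: order2_character_def)
  define i where "i g = (of_nat (subdegree (s g - fps_X)) :: complex)" for g
  define ac where "ac = artin_char G (\<lambda>g f. f oo s g)"
  have ac: "of_int (ac g) = - i g" if "g \<in> carrier G - {\<one>}" for g
    using that by (simp add: ac_def artin_char_def i_def s_nth_0)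
  have ac1: "of_int (ac \<one>) = (\<Sum>g\<in>carrier G - {\<one>}. i g)"
    by (auto simp: ac_def artin_char_def i_def s_nth_0 sum_negf intro!: sum.cong)
  have "(\<Sum>g\<in>carrier G. cnj (\<chi> g) * of_int (ac g)) = of_int (ac \<one>) + (\<Sum>g\<in>carrier G - {\<one>}. cnj (\<chi> g) * of_int (ac g))"
    using fin by (subst sum.remove[of _ \<one>]) (simp_all add: one)
  also have "\<dots> = (\<Sum>g\<in>carrier G - {\<one>}. (1 - \<chi> g) * i g)"
    unfolding ac1 sum.distrib[symmetric]
  proof (intro sum.cong refl)
    fix g assume g: "g \<in> carrier G - {\<one>}"
    then show "i g + cnj (\<chi> g) * of_int (ac g) = (1 - \<chi> g) * i g"
      using val[of g] ac[OF g] by auto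
  qed
  also have "\<dots> = (\<Sum>g\<in>A. 2 * i g)"
    using fin val one by (intro sum.mono_neutral_cong_right) (fastforce simp: A_def)+
  also have "\<dots> = 2 * of_nat (m * card A)"
    unfolding deg[symmetric] by (simp add: i_def sum_distrib_left)
  finally have num: "(\<Sum>g\<in>carrier G. cnj (\<chi> g) * of_int (ac g)) = of_nat m * of_nat (2 * card A)"
    by simp
  \<comment> \<open>Translation by an element with value -1 exchanges \<open>A\<close> and its
    complement.\<close>
  have "bij_betw (\<lambda>g. a \<otimes> g) A (carrier G - A)"
  proof (rule bij_betw_byWitness[where f' = "\<lambda>g. inv a \<otimes> g"])
    have "- \<chi> (inv a) = 1"
      using mult[of a "inv a"] a one by simp
    then have inv: "\<chi> (inv a) = -1"
      by (metis minus_minus)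
    show "(\<lambda>g. a \<otimes> g) ` A \<subseteq> carrier G - A"
      using a by (auto simp: A_def mult)
    have "\<chi> g = 1" if "g \<in> carrier G - A" for g
      using that val[of g] by (auto simp: A_def)
    then show "(\<lambda>g. inv a \<otimes> g) ` (carrier G - A) \<subseteq> A"
      using a inv by (force simp: A_def mult)
  qed (use a in \<open>auto simp: A_def simp flip: m_assoc\<close>)
  then have "card (carrier G - A) = card A"
    by (rule bij_betw_same_card[symmetric])
  moreover have "card (carrier G - A) = card (carrier G) - card A" "card A \<le> card (carrier G)"
    using fin by (auto simp: A_def intro!: card_Diff_subset card_mono)
  ultimately have "2 * card A = Coset.order G"
    by (simp add: Coset.order_def)
  moreover have "Coset.order G > 0"
    using fin order_gt_0_iff_finite by blast
  ultimately show ?thesis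
    using num by (simp add: artin_mult_def ac_def)
qed

end

theorem proposition4p7:
  fixes n :: nat
  assumes "CHAR('k::alg_closed_field) = 2"
    and "n \<ge> 2"
  shows "\<exists>\<phi> :: quat_gen letter list set \<Rightarrow> 'k fps \<Rightarrow> 'k fps. simple_local_action n \<phi>"
proof -
  interpret quaternion n
    by unfold_locales fact
  obtain s :: "quat_gen letter list set \<Rightarrow> 'k fps" where s: "series_action G s"
    "{g \<in> carrier G. s g = fps_X} = H n"
    and deg: "\<And>A. A \<subseteq> carrier G - H 1 \<Longrightarrow> \<forall>g\<in>A. \<forall>h\<in>H 1. g \<otimes>\<^bsub>G\<^esub> h \<in> A \<Longrightarrow>
      (\<Sum>g\<in>A. subdegree (s g - fps_X)) = 2 * card A"
    using action_with_kernel_H[OF assms(1), of n] assms(2) by auto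
  interpret S: series_action G s by fact
  have "H n = {\<one>\<^bsub>G\<^esub>}"
    by (auto simp: H_def tau_pow_order simp flip: nat_pow_pow)
  then have "local_action G (\<lambda>g f. f oo s g)"
    using s(2) by (intro S.local_action) (simp add: S.act_ker_def)
  \<comment> \<open>All quadratic characters have conductor 2, which settles the three numerical
    conditions at once.\<close>
  moreover have "artin_mult G (\<lambda>g f. f oo s g) \<chi> = 2" if \<chi>: "order2_character G \<chi>" for \<chi>
  proof -
    have "(\<Sum>g\<in>{g \<in> carrier G. \<chi> g = -1}. subdegree (s g - fps_X)) = 2 * card {g \<in> carrier G. \<chi> g = -1}"
    proof (rule deg)
      show "{g \<in> carrier G. \<chi> g = -1} \<subseteq> carrier G - H 1"
        using character_trivial_on_H[OF \<chi>] by auto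
      have "h \<in> carrier G" if "h \<in> H 1" for h
        using that by (auto simp: H_def)
      then show "\<forall>g\<in>{g \<in> carrier G. \<chi> g = -1}. \<forall>h\<in>H 1. g \<otimes>\<^bsub>G\<^esub> h \<in> {g \<in> carrier G. \<chi> g = -1}"
        using character_trivial_on_H[OF \<chi>] \<chi> by (auto simp: order2_character_def)
    qed
    from S.artin_mult_order2_character[OF finite_carrier \<chi> this] show ?thesis
      by simp
  qed
  ultimately have "simple_local_action n (\<lambda>g f. f oo s g)"
    using quat_char(1)[OF assms(2)] unfolding simple_local_action_def G_def by simp
  then show ?thesis
    by blast
qed

end
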